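(* Let $(G,B_0)$ be a radius-two root with at most two fertile hubs. Then every dead node $K_\sigma$ has rank at most one, and every dead stratum $\sigma$ admits an unconditional fibre.
   Context: A radius-two root is a pair $(G,B_0)$ where $G$ is a connected simple finite graph of radius at most two with a distinguished vertex $o$ of eccentricity at most two (the centre), and $B_0$ is a breadth-first spanning tree of $G$ rooted at $o$ (tree distance from $o$ equals graph distance). The neighbours of $o$ are the hubs; the vertices at distance two from $o$ are the children. A hub is fertile if it has a child attached to it in $B_0$, barren otherwise. Let $M=M(G)$ be the graphic matroid on the edge set $E$ of $G$ with basis $B_0$ and $R=E\setminus B_0$. For $i\in R$, $C_i$ is the fundamental circuit, the unique circuit in $B_0\cup\{i\}$. For $\sigma\subseteq R$ put $m_\sigma(e)=\#\{i\in\sigma:e\in C_i\}$, $U_\sigma=\{e:m_\sigma(e)=1\}$, $A_\sigma=\{e:m_\sigma(e)\ge1\}$. A stratum is a nonempty $\sigma\subseteq R$; it is dead if $U_\sigma$ is independent in $M$ (a forest of $G$), live otherwise. The baseline $b_\sigma\in\mathbb N^\sigma$ is $b_\sigma(i)=|C_i\cap U_\sigma|$. A stratum $\tau$ can be fired from $a\in\mathbb N^\sigma$ ($\tau\subseteq\sigma$) if $a_i\ge b_\tau(i)$ for all $i\in\tau$. For dead $\sigma$ the dead node is $K_\sigma=(M|A_\sigma)/U_\sigma$. For a matroid $N$ of rank $d$, $h(N)=(h_0,\dots,h_d)$ is the $h$-vector of its independence complex: $T_N(x,1)=\sum_kh_kx^{d-k}$. A multicomplex is a finite set of exponent vectors closed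 under passing to coordinatewise smaller vectors; it is pure if all maximal elements have the same degree $|a|=\sum a_i$; its degree sequence counts the elements of each degree (trailing zeros ignored). An unconditional fibre at a dead stratum $\sigma$ is a pure multicomplex $F(\sigma)\subseteq\mathbb N^\sigma$ with degree sequence $h(K_\sigma)$ such that for every $m\in F(\sigma)$ and every nonempty $\tau\subsetneq\sigma$ that can be fired from $b_\sigma+m$, the stratum $\tau$ is dead and $(b_\sigma+m)|_\tau=b_\tau$. *)

theory Defs
  imports "HOL-Computational_Algebra.Polynomial"
begin

section \<open>Simple graphs\<close>

record 'v sgraph =
  verts :: "'v set"
  edges :: "'v set set"

definition simple_finite_graph :: "'v sgraph \<Rightarrow> bool" where
  "simple_finite_graph G \<longleftrightarrow>
     finite (verts G) \<and> (\<forall>e\<in>edges G. e \<subseteq> verts G \<and> card e = 2)"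

definition walk :: "'v sgraph \<Rightarrow> 'v list \<Rightarrow> bool" where
  "walk G p \<longleftrightarrow> p \<noteq> [] \<and> set p \<subseteq> verts G \<and> successively (\<lambda>u v. {u, v} \<in> edges G) p"

definition graph_connected :: "'v sgraph \<Rightarrow> bool" where
  "graph_connected G \<longleftrightarrow> verts G \<noteq> {} \<and>
     (\<forall>u\<in>verts G. \<forall>v\<in>verts G. \<exists>p. walk G p \<and> hd p = u \<and> last p = v)"

text \<open>Only meaningful when \<open>u\<close> and \<open>v\<close> are joined by a walk; it is used for connected graphs only.\<close>

definition graph_dist :: "'v sgraph \<Rightarrow> 'v \<Rightarrow> 'v \<Rightarrow> nat" where
  "graph_dist G u v = (LEAST n. \<exists>p. walk G p \<and> hd p = u \<and> last p = v \<and> length p = Suc n)"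

definition eccentricity :: "'v sgraph \<Rightarrow> 'v \<Rightarrow> nat" where
  "eccentricity G u = Max (graph_dist G u ` verts G)"

definition graph_radius :: "'v sgraph \<Rightarrow> nat" where
  "graph_radius G = Min (eccentricity G ` verts G)"

text \<open>A cycle is given by the cyclic sequence \<open>p\<close> of its distinct vertices.\<close>

definition cycle_in :: "'v set set \<Rightarrow> 'v list \<Rightarrow> bool" where
  "cycle_in F p \<longleftrightarrow> 3 \<le> length p \<and> distinct p \<and>
     successively (\<lambda>u v. {u, v} \<in> F) p \<and> {last p, hd p} \<in> F"

definition forest :: "'v set set \<Rightarrow> bool" where
  "forest F \<longleftrightarrow> (\<nexists>p. cycle_in F p)"

definition spanning_tree :: "'v sgraph \<Rightarrow> 'v set set \<Rightarrow> bool" where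
  "spanning_tree G B \<longleftrightarrow>
     B \<subseteq> edges G \<and> forest B \<and> graph_connected \<lparr>verts = verts G, edges = B\<rparr>"

definition bfs_spanning_tree :: "'v sgraph \<Rightarrow> 'v \<Rightarrow> 'v set set \<Rightarrow> bool" where
  "bfs_spanning_tree G c B \<longleftrightarrow> spanning_tree G B \<and>
     (\<forall>v\<in>verts G. graph_dist \<lparr>verts = verts G, edges = B\<rparr> c v = graph_dist G c v)"


section \<open>Matroids\<close>

text \<open>The ground set together with the independence predicate. The matroid axioms are not built
  into the type; only the graphic matroid and its minors are ever considered.\<close>

record 'e matroid =
  ground :: "'e set"
  indep :: "'e set \<Rightarrow> bool"

definition graphic_matroid :: "'v sgraph \<Rightarrow> 'v set matroid" where
  "graphic_matroid G = \<lparr>ground = edges G, indep = (\<lambda>F. F \<subseteq> edges G \<and> forest F)\<rparr>"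

definition circuit :: "'e matroid \<Rightarrow> 'e set \<Rightarrow> bool" where
  "circuit M C \<longleftrightarrow> C \<subseteq> ground M \<and> \<not> indep M C \<and> (\<forall>D. D \<subset> C \<longrightarrow> indep M D)"

definition basis_of :: "'e matroid \<Rightarrow> 'e set \<Rightarrow> 'e set \<Rightarrow> bool" where
  "basis_of M X I \<longleftrightarrow>
     I \<subseteq> X \<and> indep M I \<and> (\<forall>J. I \<subset> J \<and> J \<subseteq> X \<longrightarrow> \<not> indep M J)"

definition rank_of :: "'e matroid \<Rightarrow> 'e set \<Rightarrow> nat" where
  "rank_of M X = Max (card ` {I. I \<subseteq> X \<and> indep M I})"

definition rank :: "'e matroid \<Rightarrow> nat" where
  "rank M = rank_of M (ground M)"

definition restriction :: "'e matroid \<Rightarrow> 'e set \<Rightarrow> 'e matroid" where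
  "restriction M X = \<lparr>ground = ground M \<inter> X, indep = (\<lambda>I. I \<subseteq> X \<and> indep M I)\<rparr>"

definition contraction :: "'e matroid \<Rightarrow> 'e set \<Rightarrow> 'e matroid" where
  "contraction M X =
     \<lparr>ground = ground M - X,
      indep = (\<lambda>I. I \<subseteq> ground M - X \<and> (\<exists>J. basis_of M (ground M \<inter> X) J \<and> indep M (I \<union> J)))\<rparr>"

text \<open>The corank-nullity form of the Tutte polynomial, evaluated at elements \<open>x\<close> and \<open>y\<close> of an
  arbitrary commutative ring.\<close>

definition tutte :: "'e matroid \<Rightarrow> 'r::comm_ring_1 \<Rightarrow> 'r \<Rightarrow> 'r" where
  "tutte M x y =
     (\<Sum>X\<in>Pow (ground M). (x - 1) ^ (rank M - rank_of M X) * (y - 1) ^ (card X - rank_of M X))"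

text \<open>Here \<open>[:0, 1:]\<close> is the polynomial indeterminate, so the polynomial below is \<open>T(x,1)\<close>.
  The entries beyond the rank are zero (without the case distinction, truncated subtraction would
  repeat the constant coefficient).\<close>

definition h_vector :: "'e matroid \<Rightarrow> nat \<Rightarrow> int" where
  "h_vector M k =
     (if k \<le> rank M then coeff (tutte M [:0, 1:] (1 :: int poly)) (rank M - k) else 0)"


section \<open>Multicomplexes\<close>

text \<open>The elements of \<open>\<nat>\<^sup>\<sigma>\<close> are the functions into \<^typ>\<open>nat\<close> vanishing outside \<open>\<sigma>\<close>; the
  coordinatewise order is then the pointwise order of functions.\<close>

definition exponents :: "'e set \<Rightarrow> ('e \<Rightarrow> nat) set" where
  "exponents \<sigma> = {a. \<forall>i. i \<notin> \<sigma> \<longrightarrow> a i = 0}"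

definition total_degree :: "'e set \<Rightarrow> ('e \<Rightarrow> nat) \<Rightarrow> nat" where
  "total_degree \<sigma> a = (\<Sum>i\<in>\<sigma>. a i)"

definition multicomplex :: "'e set \<Rightarrow> ('e \<Rightarrow> nat) set \<Rightarrow> bool" where
  "multicomplex \<sigma> F \<longleftrightarrow> finite F \<and> F \<subseteq> exponents \<sigma> \<and> (\<forall>a\<in>F. \<forall>b\<in>exponents \<sigma>. b \<le> a \<longrightarrow> b \<in> F)"

definition maximal_in :: "('e \<Rightarrow> nat) set \<Rightarrow> ('e \<Rightarrow> nat) \<Rightarrow> bool" where
  "maximal_in F a \<longleftrightarrow> a \<in> F \<and> (\<forall>b\<in>F. a \<le> b \<longrightarrow> b = a)"

definition pure_multicomplex :: "'e set \<Rightarrow> ('e \<Rightarrow> nat) set \<Rightarrow> bool" where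
  "pure_multicomplex \<sigma> F \<longleftrightarrow> multicomplex \<sigma> F \<and>
     (\<forall>a b. maximal_in F a \<and> maximal_in F b \<longrightarrow> total_degree \<sigma> a = total_degree \<sigma> b)"

definition degree_sequence :: "'e set \<Rightarrow> ('e \<Rightarrow> nat) set \<Rightarrow> nat \<Rightarrow> nat" where
  "degree_sequence \<sigma> F k = card {a \<in> F. total_degree \<sigma> a = k}"


section \<open>Strata\<close>

definition fundamental_circuit :: "'e matroid \<Rightarrow> 'e set \<Rightarrow> 'e \<Rightarrow> 'e set" where
  "fundamental_circuit M B i = (THE C. circuit M C \<and> C \<subseteq> insert i B)"

definition multiplicity_in :: "'e matroid \<Rightarrow> 'e set \<Rightarrow> 'e set \<Rightarrow> 'e \<Rightarrow> nat" where
  "multiplicity_in M B \<sigma> e = card {i \<in> \<sigma>. e \<in> fundamental_circuit M B i}"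

definition once_covered :: "'e matroid \<Rightarrow> 'e set \<Rightarrow> 'e set \<Rightarrow> 'e set" where
  "once_covered M B \<sigma> = {e \<in> ground M. multiplicity_in M B \<sigma> e = 1}"

definition covered :: "'e matroid \<Rightarrow> 'e set \<Rightarrow> 'e set \<Rightarrow> 'e set" where
  "covered M B \<sigma> = {e \<in> ground M. multiplicity_in M B \<sigma> e \<ge> 1}"

definition stratum :: "'e matroid \<Rightarrow> 'e set \<Rightarrow> 'e set \<Rightarrow> bool" where
  "stratum M B \<sigma> \<longleftrightarrow> \<sigma> \<noteq> {} \<and> \<sigma> \<subseteq> ground M - B"

definition dead :: "'e matroid \<Rightarrow> 'e set \<Rightarrow> 'e set \<Rightarrow> bool" where
  "dead M B \<sigma> \<longleftrightarrow> stratum M B \<sigma> \<and> indep M (once_covered M B \<sigma>)"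

definition baseline :: "'e matroid \<Rightarrow> 'e set \<Rightarrow> 'e set \<Rightarrow> 'e \<Rightarrow> nat" where
  "baseline M B \<sigma> i =
     (if i \<in> \<sigma> then card (fundamental_circuit M B i \<inter> once_covered M B \<sigma>) else 0)"

definition can_fire :: "'e matroid \<Rightarrow> 'e set \<Rightarrow> 'e set \<Rightarrow> ('e \<Rightarrow> nat) \<Rightarrow> bool" where
  "can_fire M B \<tau> a \<longleftrightarrow> (\<forall>i\<in>\<tau>. a i \<ge> baseline M B \<tau> i)"

definition dead_node :: "'e matroid \<Rightarrow> 'e set \<Rightarrow> 'e set \<Rightarrow> 'e matroid" where
  "dead_node M B \<sigma> = contraction (restriction M (covered M B \<sigma>)) (once_covered M B \<sigma>)"

definition unconditional_fibre ::
    "'e matroid \<Rightarrow> 'e set \<Rightarrow> 'e set \<Rightarrow> ('e \<Rightarrow> nat) set \<Rightarrow> bool" where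
  "unconditional_fibre M B \<sigma> F \<longleftrightarrow>
     pure_multicomplex \<sigma> F \<and>
     (\<forall>k. int (degree_sequence \<sigma> F k) = h_vector (dead_node M B \<sigma>) k) \<and>
     (\<forall>m\<in>F. \<forall>\<tau>. \<tau> \<noteq> {} \<and> \<tau> \<subset> \<sigma> \<and> can_fire M B \<tau> (\<lambda>i. baseline M B \<sigma> i + m i) \<longrightarrow>
        dead M B \<tau> \<and> (\<forall>i\<in>\<tau>. baseline M B \<sigma> i + m i = baseline M B \<tau> i))"


section \<open>Radius-two roots\<close>

definition radius_two_root :: "'v sgraph \<Rightarrow> 'v \<Rightarrow> 'v set set \<Rightarrow> bool" where
  "radius_two_root G c B \<longleftrightarrow>
     simple_finite_graph G \<and> graph_connected G \<and> graph_radius G \<le> 2 \<and>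
     c \<in> verts G \<and> eccentricity G c \<le> 2 \<and> bfs_spanning_tree G c B"

definition hubs :: "'v sgraph \<Rightarrow> 'v \<Rightarrow> 'v set" where
  "hubs G c = {v \<in> verts G. {c, v} \<in> edges G}"

definition children :: "'v sgraph \<Rightarrow> 'v \<Rightarrow> 'v set" where
  "children G c = {v \<in> verts G. graph_dist G c v = 2}"

definition fertile_hubs :: "'v sgraph \<Rightarrow> 'v \<Rightarrow> 'v set set \<Rightarrow> 'v set" where
  "fertile_hubs G c B = {h \<in> hubs G c. \<exists>v\<in>children G c. {h, v} \<in> B}"

end

theory Submission
  imports Defs
begin

text \<open>
  The depth of the tree is used as follows: every vertex except the centre and the fertile hubs is
  a leaf of \<open>B\<^sub>0\<close>. With at most two fertile hubs there is a set \<open>S\<close> of at most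
  three vertices outside which all vertices are leaves (\<open>radius_two_three_inner\<close>).

  Write \<open>U\<close> and \<open>A\<close> for the edges covered exactly once and at least once by \<open>\<sigma>\<close>. Let \<open>v\<close> be a leaf
  of the tree that meets \<open>A\<close>. Its tree edge lies on \<open>C\<^sub>i\<close> precisely when \<open>v\<close> is an end of \<open>i\<close>. If
  two edges of \<open>\<sigma>\<close> end at \<open>v\<close>, both are in \<open>U\<close>; if only one does, that edge and the tree edge are in
  \<open>U\<close>. So \<open>v\<close> has degree at least two in \<open>U\<close> (\<open>vdeg_once_covered\<close>), and if \<open>U\<close> is a forest, its
  leaves belong to \<open>S\<close>. Every tree has two leaves and \<open>|S| \<le> 3\<close>, so \<open>U\<close> has just one nontrivial
  component and at most one vertex of \<open>A\<close> is missed by \<open>U\<close>. In the form of a count this reads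
  \<open>|V(A)| \<le> |U| + 2\<close> (\<open>forest_ends_bound\<close>). Hence \<open>U\<close> extends to a forest inside \<open>A\<close> by at most one
  edge, which is the bound on the rank of the dead node. Comparing with the tree edges in \<open>A\<close> gives
  \<open>|A - U| \<le> |\<sigma>| + 1\<close> (\<open>card_multiply_covered\<close>).

  For the fibre, let \<open>N\<close> be the set of nonloops and \<open>L\<close> the set of loops of the dead node. Its
  \<open>h\<close>-vector is \<open>(1, |N| - 1)\<close>, or \<open>(1)\<close> if \<open>N\<close> is empty, so the fibre should consist of \<open>0\<close> and
  of the unit vectors of a set \<open>J \<subseteq> \<sigma>\<close> with \<open>|J| = |N| - 1\<close>. Since \<open>C\<^sub>i \<inter> U\<^sub>\<sigma> \<subseteq> C\<^sub>i \<inter> U\<^sub>\<tau>\<close> for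
  \<open>i \<in> \<tau>\<close>, firing \<open>\<tau>\<close> from the baseline itself forces \<open>U\<^sub>\<tau> \<subseteq> U\<^sub>\<sigma>\<close> and equal baselines, which is
  what the definition asks for. If \<open>N\<close> is nonempty then \<open>U\<^sub>\<sigma>\<close> is a single path between two vertices of
  \<open>S\<close>, and the leaf argument applied to \<open>\<tau>\<close> excludes \<open>U\<^sub>\<tau> \<subseteq> U\<^sub>\<sigma>\<close> for proper \<open>\<tau>\<close>
  (\<open>no_proper_U_subset\<close>). So firing \<open>\<tau>\<close> after adding one unit at \<open>j\<close> means that \<open>U\<^sub>\<tau>\<close> gains exactly
  one edge \<open>e\<close>, that \<open>j\<close> is the element of \<open>\<tau>\<close> whose circuit contains \<open>e\<close>, and that the baselines
  match. The only danger is that \<open>e\<close> is a loop and \<open>U\<^sub>\<tau>\<close> contains the unique circuit of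
  \<open>U\<^sub>\<sigma> \<union> {e}\<close>. That circuit contains some \<open>i \<in> \<sigma>\<close> with \<open>e \<in> C\<^sub>i\<close> (\<open>loop_witness\<close>), and then
  \<open>i \<in> \<tau>\<close> forces \<open>j = i\<close>. So each loop spoils at most one \<open>j\<close>, and by \<open>|N| + |L| \<le> |\<sigma>| + 1\<close>
  at least \<open>|N| - 1\<close> elements remain for \<open>J\<close>.
\<close>

section \<open>Degrees in forests\<close>

definition vdeg :: "'v set set \<Rightarrow> 'v \<Rightarrow> nat" where
  "vdeg F v = card {e \<in> F. v \<in> e}"

text \<open>The elements of the cycle space over the field with two elements.\<close>

definition even_edges :: "'v set set \<Rightarrow> bool" where
  "even_edges F \<longleftrightarrow> (\<forall>v. even (vdeg F v))"

fun path_edges :: "'v list \<Rightarrow> 'v set set" where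
  "path_edges (x # y # ys) = insert {x, y} (path_edges (y # ys))"
| "path_edges _ = {}"

lemma forest_subset: "forest F \<Longrightarrow> F' \<subseteq> F \<Longrightarrow> forest F'"
  unfolding forest_def cycle_in_def
  by (metis (mono_tags, lifting) subsetD successively_mono)

lemma vdeg_mono: "finite F \<Longrightarrow> F' \<subseteq> F \<Longrightarrow> vdeg F' v \<le> vdeg F v"
  unfolding vdeg_def by (intro card_mono) auto

lemma vdeg_pos: "finite F \<Longrightarrow> 0 < vdeg F v \<longleftrightarrow> v \<in> \<Union>F"
  unfolding vdeg_def by (auto simp: card_gt_0_iff)

lemma vdeg_insert:
  assumes "finite F" "e \<notin> F"
  shows "vdeg (insert e F) v = vdeg F v + (if v \<in> e then 1 else 0)"
proof -
  have "{e' \<in> insert e F. v \<in> e'} = (if v \<in> e then insert e {e' \<in> F. v \<in> e'} else {e' \<in> F. v \<in> e'})"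
    by auto
  then show ?thesis using assms by (simp add: vdeg_def)
qed

lemma vdeg_Diff:
  assumes "finite F" "F' \<subseteq> F"
  shows "vdeg (F - F') v = vdeg F v - vdeg F' v"
proof -
  have "{e \<in> F - F'. v \<in> e} = {e \<in> F. v \<in> e} - {e \<in> F'. v \<in> e}" by auto
  moreover have "finite {e \<in> F'. v \<in> e}" using assms finite_subset by fastforce
  ultimately show ?thesis using assms by (simp add: vdeg_def card_Diff_subset subset_iff)
qed

lemma vdeg_sym_diff:
  assumes "finite F" "finite F'"
  shows "vdeg (sym_diff F F') v + 2 * vdeg (F \<inter> F') v = vdeg F v + vdeg F' v"
proof -
  let ?A = "{e \<in> F. v \<in> e}" and ?B = "{e \<in> F'. v \<in> e}"
  have f: "finite ?A" "finite ?B" using assms by auto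
  have 1: "{e \<in> sym_diff F F'. v \<in> e} = (?A - ?B) \<union> (?B - ?A)"
    and 2: "{e \<in> F \<inter> F'. v \<in> e} = ?A \<inter> ?B" by auto
  have "card ((?A - ?B) \<union> (?B - ?A)) = card (?A - ?B) + card (?B - ?A)"
    using f by (intro card_Un_disjoint) auto
  moreover have "card ?A = card (?A - ?B) + card (?A \<inter> ?B)"
    using card_Int_Diff[OF f(1), of ?B] by simp
  moreover have "card ?B = card (?B - ?A) + card (?A \<inter> ?B)"
    using card_Int_Diff[OF f(2), of ?A] by (simp add: Int_commute)
  ultimately show ?thesis unfolding vdeg_def 1 2 by linarith
qed

lemma even_edges_sym_diff:
  assumes "finite F" "finite F'" "even_edges F" "even_edges F'"
  shows "even_edges (sym_diff F F')"
  unfolding even_edges_def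
proof
  fix v
  have "even (vdeg (sym_diff F F') v + 2 * vdeg (F \<inter> F') v)"
    using vdeg_sym_diff[OF assms(1,2)] assms(3,4) by (simp add: even_edges_def)
  then show "even (vdeg (sym_diff F F') v)" by simp
qed

lemma handshake:
  assumes "finite V" "\<Union>F \<subseteq> V" "\<forall>e\<in>F. card e = 2"
  shows "(\<Sum>v\<in>V. vdeg F v) = 2 * card F"
proof -
  have fF: "finite F" using assms(1,2) finite_UnionD finite_subset by blast
  have "(\<Sum>v\<in>V. vdeg F v) = (\<Sum>v\<in>V. \<Sum>e\<in>F. if v \<in> e then 1 else 0)"
    unfolding vdeg_def using fF by (intro sum.cong refl) (simp add: sum.If_cases Int_def)
  also have "\<dots> = (\<Sum>e\<in>F. \<Sum>v\<in>V. if v \<in> e then 1 else 0)" by (rule sum.swap)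
  also have "\<dots> = (\<Sum>e\<in>F. 2)"
  proof (rule sum.cong[OF refl])
    fix e assume e: "e \<in> F"
    have "V \<inter> {v. v \<in> e} = e" using e assms(2) by auto
    then show "(\<Sum>v\<in>V. if v \<in> e then 1 else 0) = (2::nat)"
      using assms(1,3) e by (simp add: sum.If_cases)
  qed
  finally show ?thesis by simp
qed

lemma finite_Union_edges:
  assumes "finite F" "\<forall>e\<in>F. card e = 2"
  shows "finite (\<Union>F)"
proof (rule finite_Union[OF assms(1)])
  fix e assume "e \<in> F"
  then have "0 < card e" using assms(2) by simp
  then show "finite e" by (rule card_ge_0_finite)
qed

text \<open>An end of a longest path is a leaf: a second edge at that end would lead back into the path and
  close a cycle.\<close>

lemma forest_has_leaf:
  assumes "finite F" "\<forall>e\<in>F. card e = 2" "F \<noteq> {}" "forest F"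
  shows "\<exists>v. vdeg F v = 1"
proof (rule ccontr)
  assume no: "\<nexists>v. vdeg F v = 1"
  define P where "P = (\<lambda>p. distinct p \<and> set p \<subseteq> \<Union>F \<and> successively (\<lambda>u v. {u, v} \<in> F) p)"
  have fV: "finite (\<Union>F)"
    using assms(1,2) by (rule finite_Union_edges)
  obtain e where "e \<in> F" using assms(3) by auto
  then obtain a b where "e = {a, b}" "a \<noteq> b" using assms(2) by (meson card_2_iff)
  then have P0: "P [a, b]" using \<open>e \<in> F\<close> by (auto simp: P_def)
  have bound: "\<And>p. P p \<Longrightarrow> length p \<le> card (\<Union>F)"
    unfolding P_def using fV by (metis card_mono distinct_card)
  define p where "p = arg_max length P"
  have Pp: "P p" and max: "\<And>q. P q \<Longrightarrow> length q \<le> length p"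
    using arg_max_nat_lemma[of P "[a, b]" length "Suc (card (\<Union>F))"] P0 bound le_imp_less_Suc
    unfolding p_def by blast+
  have "2 \<le> length p" using max[OF P0] by simp
  then obtain x y zs where p: "p = x # y # zs"
    by (metis Suc_le_length_iff numeral_2_eq_2)
  have xy: "{x, y} \<in> F" "x \<noteq> y" using Pp by (auto simp: p P_def)
  have "{e \<in> F. x \<in> e} \<noteq> {{x, y}}"
  proof
    assume "{e \<in> F. x \<in> e} = {{x, y}}"
    then have "vdeg F x = 1" by (simp add: vdeg_def)
    then show False using no by blast
  qed
  then obtain e where e: "e \<in> F" "x \<in> e" "e \<noteq> {x, y}" using xy by blast
  then obtain w where w: "e = {x, w}" "w \<noteq> x"
    using assms(2) by (metis card_2_iff doubleton_eq_iff insertE singletonD)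
  have wy: "w \<noteq> y" using e w by auto
  have "w \<in> set p"
  proof (rule ccontr)
    assume "w \<notin> set p"
    then have "P (w # p)" using Pp e w by (auto simp: P_def p insert_commute)
    then show False using max by fastforce
  qed
  then have "w \<in> set zs" using w wy by (simp add: p)
  then obtain as bs where zs: "zs = as @ w # bs" by (meson split_list)
  have "successively (\<lambda>u v. {u, v} \<in> F) ((x # y # as @ [w]) @ bs)"
    using Pp by (simp add: P_def p zs)
  then have "successively (\<lambda>u v. {u, v} \<in> F) (x # y # as @ [w])"
    by (metis successively_append_iff)
  then have "cycle_in F (x # y # as @ [w])"
    using Pp e(1) unfolding cycle_in_def by (auto simp: P_def p zs w insert_commute)
  then show False using assms(4) by (auto simp: forest_def)
qed

text \<open>Induction by deleting a leaf together with its edge.\<close>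

lemma forest_card_less_vertices:
  assumes "finite F" "\<forall>e\<in>F. card e = 2" "F \<noteq> {}" "forest F"
  shows "card F < card (\<Union>F)"
  using assms
proof (induction "card F" arbitrary: F rule: less_induct)
  case less
  have fV: "finite (\<Union>F)"
    using less.prems(1,2) by (rule finite_Union_edges)
  obtain v where v: "vdeg F v = 1" using forest_has_leaf less.prems by blast
  then obtain e where e: "{e \<in> F. v \<in> e} = {e}" by (auto simp: vdeg_def card_1_singleton_iff)
  then have eF: "e \<in> F" "v \<in> e" by auto
  show ?case
  proof (cases "F - {e} = {}")
    case True
    then have "F = {e}" using eF by auto
    then show ?thesis using less.prems by simp
  next
    case False
    have c: "card F = Suc (card (F - {e}))" using eF less.prems(1) by (metis card_Suc_Diff1)
    have "card (F - {e}) < card (\<Union>(F - {e}))"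
      using False less.prems c forest_subset[of F "F - {e}"] by (intro less.hyps) auto
    also have "\<dots> \<le> card (\<Union>F - {v})"
      using e fV by (intro card_mono) auto
    also have "Suc \<dots> = card (\<Union>F)"
      using eF fV by (metis UnionI card_Suc_Diff1)
    finally show ?thesis using c by simp
  qed
qed

lemma even_forest_empty:
  assumes "finite F" "\<forall>e\<in>F. card e = 2" "even_edges F" "forest F"
  shows "F = {}"
proof (rule ccontr)
  assume "F \<noteq> {}"
  then obtain v where "vdeg F v = 1" using forest_has_leaf[OF assms(1,2) _ assms(4)] by blast
  moreover have "even (vdeg F v)" using assms(3) by (simp add: even_edges_def)
  ultimately show False by simp
qed

lemma finite_path_edges: "finite (path_edges p)"
  by (induction p rule: path_edges.induct) auto

lemma path_edges_subset: "successively (\<lambda>u v. {u, v} \<in> F) p \<Longrightarrow> path_edges p \<subseteq> F"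
  by (induction p rule: path_edges.induct) auto

lemma path_edges_vertices: "e \<in> path_edges p \<Longrightarrow> e \<subseteq> set p"
  by (induction p rule: path_edges.induct) auto

text \<open>The boundary of a path modulo two is the sum of its two ends.\<close>

lemma path_edges_odd:
  "distinct (x # xs) \<Longrightarrow> odd (vdeg (path_edges (x # xs)) v) \<longleftrightarrow> (v = x) \<noteq> (v = last (x # xs))"
proof (induction xs arbitrary: x)
  case Nil
  then show ?case by (simp add: vdeg_def)
next
  case (Cons y ys)
  have "{x, y} \<notin> path_edges (y # ys)"
    using Cons.prems path_edges_vertices[of "{x, y}" "y # ys"] by auto
  then have "vdeg (path_edges (x # y # ys)) v
      = vdeg (path_edges (y # ys)) v + (if v \<in> {x, y} then 1 else 0)"
    by (simp add: vdeg_insert finite_path_edges)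
  moreover have "odd (vdeg (path_edges (y # ys)) v) \<longleftrightarrow> (v = y) \<noteq> (v = last (y # ys))"
    using Cons by simp
  moreover have "last (y # ys) \<noteq> x" using Cons.prems last_in_set[of "y # ys"] by auto
  ultimately show ?case using Cons.prems by auto
qed

text \<open>The edge set of a cycle is even. Together with \<open>even_forest_empty\<close> this lets even sets
  replace cycles as vertex sequences: a finite set of two-element edges is a forest precisely when it
  has no nonempty even subset.\<close>

lemma cycle_contains_even:
  assumes "\<not> forest F"
  obtains D where "D \<subseteq> F" "finite D" "D \<noteq> {}" "even_edges D"
proof -
  obtain p where p: "cycle_in F p" using assms by (auto simp: forest_def)
  obtain x y zs where p': "p = x # y # zs" and zs: "zs \<noteq> []"
    using p unfolding cycle_in_def
    by (cases p rule: path_edges.cases) (auto simp: Suc_le_eq numeral_3_eq_3)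
  define D where "D = insert {last p, x} (path_edges p)"
  have lx: "last p \<noteq> x" "last p \<noteq> y"
    using p zs last_in_set[of zs] by (auto simp: cycle_in_def p')
  have "{last p, x} \<notin> path_edges p"
    using lx path_edges_vertices[of "{last p, x}" "y # zs"] p
    by (auto simp: p' cycle_in_def doubleton_eq_iff)
  then have "vdeg D v = vdeg (path_edges p) v + (if v \<in> {last p, x} then 1 else 0)" for v
    by (simp add: D_def vdeg_insert finite_path_edges)
  moreover have "odd (vdeg (path_edges p) v) \<longleftrightarrow> (v = x) \<noteq> (v = last p)" for v
    using path_edges_odd[of x "y # zs" v] p by (simp add: p' cycle_in_def)
  ultimately have "even_edges D" using lx by (auto simp: even_edges_def)
  moreover have "D \<subseteq> F"
    using p path_edges_subset[of F p] by (auto simp: D_def cycle_in_def p')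
  ultimately show ?thesis using that[of D] by (auto simp: D_def finite_path_edges)
qed

text \<open>Two such sets both contain \<open>e\<close>, so their symmetric difference is an even subset of the
  forest, hence empty.\<close>

lemma even_edges_unique:
  assumes "finite F" "\<forall>e\<in>F. card e = 2" "forest F" "card e = 2"
    and "D \<subseteq> insert e F" "even_edges D" "D \<noteq> {}"
    and "D' \<subseteq> insert e F" "even_edges D'" "D' \<noteq> {}"
  shows "D = D'"
proof -
  have fin: "finite D" "finite D'" using assms by (auto intro: finite_subset)
  have "e \<in> X" if "X \<subseteq> insert e F" "even_edges X" "X \<noteq> {}" for X
  proof (rule ccontr)
    assume "e \<notin> X"
    then have "X \<subseteq> F" using that by auto
    then have "finite X" "\<forall>e\<in>X. card e = 2" "forest X"
      using assms(1-3) finite_subset forest_subset by blast+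
    then show False using even_forest_empty that(2,3) by blast
  qed
  then have e: "e \<in> D" "e \<in> D'" using assms by auto
  then have sub: "sym_diff D D' \<subseteq> F" using assms by auto
  have "sym_diff D D' = {}"
  proof (rule even_forest_empty)
    show "finite (sym_diff D D')" using fin by simp
    show "\<forall>e\<in>sym_diff D D'. card e = 2" using sub assms(2) by blast
    show "even_edges (sym_diff D D')" using even_edges_sym_diff[OF fin] assms by blast
    show "forest (sym_diff D D')" by (rule forest_subset[OF assms(3) sub])
  qed
  then show ?thesis by auto
qed

section \<open>Forests with at most three ends\<close>

text \<open>The degree sum \<open>2 |F|\<close> is at most \<open>2 |V(F)| - 2\<close>, while every vertex contributes at least two,
  or at least one if it is in \<open>S\<close>.\<close>

lemma forest_two_ends:
  assumes "finite F" "\<forall>e\<in>F. card e = 2" "F \<noteq> {}" "forest F"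
    and "\<forall>v\<in>\<Union>F - S. 2 \<le> vdeg F v"
  shows "2 \<le> card (S \<inter> \<Union>F)"
proof -
  have fV: "finite (\<Union>F)"
    using assms(1,2) by (rule finite_Union_edges)
  have "(\<Sum>v\<in>\<Union>F. 2) \<le> (\<Sum>v\<in>\<Union>F. vdeg F v + (if v \<in> S then 1 else 0))"
  proof (rule sum_mono)
    fix v assume v: "v \<in> \<Union>F"
    then have "0 < vdeg F v" using vdeg_pos[OF assms(1)] by blast
    then show "2 \<le> vdeg F v + (if v \<in> S then 1 else 0)" using v assms(5) by auto
  qed
  also have "\<dots> = 2 * card F + card (S \<inter> \<Union>F)"
    using handshake[OF fV subset_refl assms(2)] fV
    by (simp add: sum.distrib sum.If_cases Int_commute)
  finally show ?thesis using forest_card_less_vertices[OF assms(1-4)] by simp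
qed

text \<open>Of the vertices in \<open>S\<close> at least two lie on \<open>F\<close>, so at most one is isolated. Counting degrees,
  with deficiency one for a vertex of \<open>S\<close> on \<open>F\<close> and two for one off \<open>F\<close>, the total deficiency
  is at most four. In the extremal case all degree bounds are attained, and \<open>F\<close> is a path.\<close>

lemma forest_ends_bound:
  assumes "finite F" "\<forall>e\<in>F. card e = 2" "F \<noteq> {}" "forest F"
    and "finite V" "\<Union>F \<subseteq> V" "finite S" "card S \<le> 3"
    and "\<forall>v\<in>V - S. 2 \<le> vdeg F v"
  shows "card V \<le> card F + 2"
    and "card V = card F + 2 \<Longrightarrow> \<forall>v\<in>\<Union>F. vdeg F v = (if v \<in> S then 1 else 2)"
proof -
  define pen where "pen v = (if v \<in> S then if v \<in> \<Union>F then 1 else 2 else 0 :: nat)" for v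
  have le: "2 \<le> vdeg F v + pen v" if "v \<in> V" for v
    using that assms(9) vdeg_pos[OF assms(1), of v] by (auto simp: pen_def)
  have k: "2 \<le> card (S \<inter> \<Union>F)"
    using assms by (intro forest_two_ends) auto
  have "(\<Sum>v\<in>V. pen v) = (\<Sum>v\<in>V \<inter> S. pen v)"
    using assms(5) by (intro sum.mono_neutral_right) (auto simp: pen_def)
  also have "\<dots> \<le> (\<Sum>v\<in>S. pen v)"
    using assms(7) by (intro sum_mono2) auto
  finally have "(\<Sum>v\<in>V. pen v) \<le> (\<Sum>v\<in>S. pen v)" .
  moreover have "(\<Sum>v\<in>S. pen v) + card (S \<inter> \<Union>F) = (\<Sum>v\<in>S. 2)"
  proof -
    have "card (S \<inter> \<Union>F) = (\<Sum>v\<in>S. if v \<in> \<Union>F then 1 else 0)"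
      using assms(7) by (simp add: sum.If_cases del: Union_iff)
    then have "(\<Sum>v\<in>S. pen v) + card (S \<inter> \<Union>F)
        = (\<Sum>v\<in>S. pen v + (if v \<in> \<Union>F then 1 else 0))" by (simp only: sum.distrib)
    also have "\<dots> = (\<Sum>v\<in>S. 2)" by (intro sum.cong) (auto simp: pen_def)
    finally show ?thesis .
  qed
  ultimately have "(\<Sum>v\<in>V. pen v) \<le> 4" using k assms(8) by simp
  then have ub: "(\<Sum>v\<in>V. vdeg F v + pen v) \<le> 2 * card F + 4"
    using handshake[OF assms(5,6,2)] by (simp add: sum.distrib)
  have lb: "(\<Sum>v\<in>V. 2) \<le> (\<Sum>v\<in>V. vdeg F v + pen v)" using le by (intro sum_mono) auto
  show "card V \<le> card F + 2" using lb ub by simp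
  assume "card V = card F + 2"
  then have eq: "(\<Sum>v\<in>V. vdeg F v + pen v) = (\<Sum>v\<in>V. 2)" using lb ub by simp
  show "\<forall>v\<in>\<Union>F. vdeg F v = (if v \<in> S then 1 else 2)"
  proof
    fix v assume v: "v \<in> \<Union>F"
    then have "vdeg F v + pen v = 2"
      using sum_mono_inv[OF eq[symmetric] le _ assms(5), of v] assms(6) by auto
    moreover have "pen v = (if v \<in> S then 1 else 0)"
      unfolding pen_def using v by (simp del: Union_iff)
    ultimately show "vdeg F v = (if v \<in> S then 1 else 2)" by (simp split: if_splits)
  qed
qed

text \<open>A subforest that satisfies the same degree bounds has at each of its vertices all the edges of
  \<open>F\<close>, so it and its complement in \<open>F\<close> are vertex-disjoint. If both were nonempty, each would need
  two ends in \<open>S\<close>.\<close>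

lemma forest_two_ends_rigid:
  assumes "finite F" "\<forall>e\<in>F. card e = 2" "forest F"
    and deg: "\<forall>v\<in>\<Union>F. vdeg F v = (if v \<in> S then 1 else 2)"
    and "finite S" "card S \<le> 3"
    and "F' \<subseteq> F" "F' \<noteq> {}" "\<forall>v\<in>\<Union>F' - S. 2 \<le> vdeg F' v"
  shows "F' = F"
proof (rule ccontr)
  assume "F' \<noteq> F"
  let ?D = "F - F'"
  have fF': "finite F'" using assms finite_subset by blast
  have same: "vdeg F' v = vdeg F v" if "v \<in> \<Union>F'" for v
  proof -
    have "v \<in> \<Union>F" using that assms(7) by auto
    then show ?thesis
      using that deg assms(9) vdeg_mono[OF assms(1,7), of v] vdeg_pos[OF fF', of v] by force
  qed
  have disj: "v \<notin> \<Union>F'" if "v \<in> \<Union>?D" for v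
    using that same vdeg_Diff[OF assms(1,7), of v] vdeg_pos[of ?D v] assms(1) by fastforce
  have "vdeg ?D v = vdeg F v" if "v \<in> \<Union>?D" for v
    using vdeg_Diff[OF assms(1,7), of v] disj[OF that] vdeg_pos[OF fF', of v] by simp
  then have "2 \<le> card (S \<inter> \<Union>?D)"
    using assms(1-4,7) \<open>F' \<noteq> F\<close> forest_subset[of F ?D] by (intro forest_two_ends) auto
  moreover have "2 \<le> card (S \<inter> \<Union>F')"
    using assms fF' forest_subset[of F F'] by (intro forest_two_ends) auto
  moreover have "card (S \<inter> \<Union>?D) + card (S \<inter> \<Union>F') = card ((S \<inter> \<Union>?D) \<union> (S \<inter> \<Union>F'))"
    using disj assms(5) by (subst card_Un_disjoint) auto
  moreover have "\<dots> \<le> card S" using assms(5) by (intro card_mono) auto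
  ultimately show False using assms(6) by linarith
qed

section \<open>Matroids of rank at most one\<close>

text \<open>At \<open>y = 1\<close> only independent sets contribute to the Tutte polynomial, here the empty set and the
  nonloops. So \<open>T(x,1) = (x - 1) + |N|\<close>, where \<open>N\<close> is the set of nonloops, and \<open>T(x,1) = 1\<close> if there
  are none. Truncated subtraction covers both cases in the entry for \<open>k = 1\<close>.\<close>

lemma rank_le_one_h_vector:
  fixes M :: "'e matroid"
  assumes fin: "finite (ground M)"
    and empty: "indep M {}"
    and small: "\<And>I. indep M I \<Longrightarrow> I \<subseteq> ground M \<and> card I \<le> 1"
  shows "rank M \<le> 1"
    and "h_vector M k
      = (if k = 0 then 1 else if k = 1 then int (card {e \<in> ground M. indep M {e}} - 1) else 0)"
proof -
  define N where "N = {e \<in> ground M. indep M {e}}"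
  have fN: "finite N" using fin by (simp add: N_def)
  have ind: "indep M I \<longleftrightarrow> I = {} \<or> (\<exists>e\<in>N. I = {e})" for I
  proof
    assume I: "indep M I"
    then have "finite I" "card I \<le> 1" "I \<subseteq> ground M" using small fin finite_subset by blast+
    then have "I = {} \<or> (\<exists>e. I = {e})" by (metis One_nat_def card_1_singletonE card_eq_0_iff le_SucE le_zero_eq)
    then show "I = {} \<or> (\<exists>e\<in>N. I = {e})" using I \<open>I \<subseteq> ground M\<close> by (auto simp: N_def)
  qed (use empty in \<open>auto simp: N_def\<close>)
  have rk: "rank_of M X = (if X \<inter> N = {} then 0 else 1)" for X
  proof -
    have "{I. I \<subseteq> X \<and> indep M I} = insert {} ((\<lambda>e. {e}) ` (X \<inter> N))" by (auto simp: ind)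
    then have "card ` {I. I \<subseteq> X \<and> indep M I} = (if X \<inter> N = {} then {0} else {0, 1})"
      by (auto simp: image_image)
    then show ?thesis by (simp add: rank_of_def)
  qed
  have rank: "rank M = (if N = {} then 0 else 1)"
    by (simp add: rank_def rk N_def) blast
  then show "rank M \<le> 1" by simp
  define x where "x = ([:0, 1:] - 1 :: int poly)"
  have "tutte M [:0, 1:] (1 :: int poly)
      = (\<Sum>X\<in>insert {} ((\<lambda>e. {e}) ` N). x ^ (rank M - rank_of M X))"
    unfolding tutte_def x_def[symmetric]
  proof (rule sum.mono_neutral_cong_right)
    show "finite (Pow (ground M))" using fin by simp
    show "insert {} ((\<lambda>e. {e}) ` N) \<subseteq> Pow (ground M)" by (auto simp: N_def)
    show "\<forall>X\<in>Pow (ground M) - insert {} ((\<lambda>e. {e}) ` N).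
        x ^ (rank M - rank_of M X) * (1 - 1) ^ (card X - rank_of M X) = 0"
    proof
      fix X assume X: "X \<in> Pow (ground M) - insert {} ((\<lambda>e. {e}) ` N)"
      then have "finite X" "X \<noteq> {}" using fin finite_subset by auto
      moreover have "card X \<noteq> 1 \<or> X \<inter> N = {}" using X by (auto simp: card_1_singleton_iff)
      ultimately have "card X - rank_of M X \<noteq> 0"
        using card_gt_0_iff[of X] by (auto simp: rk)
      then show "x ^ (rank M - rank_of M X) * (1 - 1) ^ (card X - rank_of M X) = 0" by simp
    qed
  qed (auto simp: rk)
  also have "\<dots> = x ^ rank M + (\<Sum>X\<in>(\<lambda>e. {e}) ` N. x ^ (rank M - rank_of M X))"
    using fN by (subst sum.insert) (auto simp: rk)
  also have "(\<Sum>X\<in>(\<lambda>e. {e}) ` N. x ^ (rank M - rank_of M X)) = of_nat (card N)"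
    by (subst sum.reindex) (auto simp: rk rank)
  finally have T: "tutte M [:0, 1:] (1 :: int poly) = x ^ rank M + of_nat (card N)" .
  have x: "x + of_nat (card N) = [:int (card N) - 1, 1:]"
    by (simp add: x_def one_pCons of_nat_poly)
  have T': "tutte M [:0, 1:] (1 :: int poly) = (if N = {} then 1 else [:int (card N) - 1, 1:])"
    using T by (simp add: rank x)
  show "h_vector M k
      = (if k = 0 then 1 else if k = 1 then int (card {e \<in> ground M. indep M {e}} - 1) else 0)"
    unfolding N_def[symmetric] h_vector_def T' rank using fN card_gt_0_iff[of N]
    by (cases "N = {}") (auto simp: le_Suc_eq)
qed

definition unit_exponent :: "'e \<Rightarrow> 'e \<Rightarrow> nat" where
  "unit_exponent j i = (if i = j then 1 else 0)"

lemma unit_multicomplex: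
  fixes \<sigma> J :: "'e set"
  assumes "finite \<sigma>" "J \<subseteq> \<sigma>"
  defines "F \<equiv> insert (\<lambda>_. 0) (unit_exponent ` J)"
  shows "pure_multicomplex \<sigma> F"
    and "degree_sequence \<sigma> F k = (if k = 0 then 1 else if k = 1 then card J else 0)"
proof -
  have fJ: "finite J" using assms finite_subset by blast
  have deg0: "total_degree \<sigma> (\<lambda>_. 0) = 0" by (simp add: total_degree_def)
  have deg1: "total_degree \<sigma> (unit_exponent j) = 1" if "j \<in> J" for j
    using that assms(1,2) by (auto simp: total_degree_def unit_exponent_def)
  have inj: "inj_on unit_exponent J"
    by (auto simp: inj_on_def unit_exponent_def fun_eq_iff split: if_splits)
  have below: "b \<in> F" if a: "a \<in> F" "b \<le> a" for a b
  proof -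
    have "b = (\<lambda>_. 0) \<or> (\<exists>j\<in>J. b = unit_exponent j)"
    proof (cases "\<forall>i. b i = 0")
      case True then show ?thesis by auto
    next
      case False
      then obtain i where i: "b i \<noteq> 0" by auto
      then obtain j where j: "j \<in> J" "a = unit_exponent j"
        using a le_funD[OF a(2), of i] by (auto simp: F_def)
      have "b k = unit_exponent j k" for k
        using le_funD[OF a(2), of k] le_funD[OF a(2), of i] i
        by (auto simp: j unit_exponent_def split: if_splits)
      then show ?thesis using j by auto
    qed
    then show ?thesis by (auto simp: F_def)
  qed
  have max: "total_degree \<sigma> a = (if J = {} then 0 else 1)" if a: "maximal_in F a" for a
  proof (cases "a \<in> unit_exponent ` J")
    case True then show ?thesis using deg1 by auto
  next
    case False
    then have a0: "a = (\<lambda>_. 0)" using a by (auto simp: maximal_in_def F_def)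
    have "J = {}"
    proof (rule ccontr)
      assume "J \<noteq> {}"
      then obtain j where "j \<in> J" by auto
      then have "unit_exponent j = a"
        using a unfolding maximal_in_def by (simp add: F_def a0 le_fun_def)
      then have "unit_exponent j j = a j" by simp
      then show False by (simp add: a0 unit_exponent_def)
    qed
    then show ?thesis using deg0 a0 by simp
  qed
  have "F \<subseteq> exponents \<sigma>" using assms(2) by (auto simp: F_def exponents_def unit_exponent_def)
  then show "pure_multicomplex \<sigma> F"
    using below max fJ unfolding pure_multicomplex_def multicomplex_def
    by (auto simp: F_def)
  have "{a \<in> F. total_degree \<sigma> a = k}
      = (if k = 0 then {\<lambda>_. 0} else if k = 1 then unit_exponent ` J else {})"
    using deg0 deg1 by (auto simp: F_def)
  then show "degree_sequence \<sigma> F k = (if k = 0 then 1 else if k = 1 then card J else 0)"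
    using card_image[OF inj] by (simp add: degree_sequence_def)
qed

section \<open>Spanning trees with at most three inner vertices\<close>

text \<open>The set \<open>S\<close> contains all inner vertices of the tree \<open>B\<close>; it may contain leaves as well.\<close>

locale three_inner_vertices =
  fixes G :: "'v sgraph" and B :: "'v set set" and S :: "'v set"
  assumes simple: "simple_finite_graph G"
    and basis: "B \<subseteq> edges G" "forest B"
    and spanning: "\<And>i. i \<in> edges G - B \<Longrightarrow> \<not> forest (insert i B)"
    and inner: "finite S" "card S \<le> 3" "\<And>v. v \<notin> S \<Longrightarrow> vdeg B v \<le> 1"
begin

abbreviation "M \<equiv> graphic_matroid G"
abbreviation "E \<equiv> edges G"
abbreviation "C \<equiv> fundamental_circuit M B"
abbreviation "U \<equiv> once_covered M B"
abbreviation "A \<equiv> covered M B"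

lemma ground_M [simp]: "ground M = E"
  and indep_M [simp]: "indep M F \<longleftrightarrow> F \<subseteq> E \<and> forest F"
  by (simp_all add: graphic_matroid_def)

lemma finite_E: "finite E"
  using simple unfolding simple_finite_graph_def
  by (meson Pow_iff finite_Pow_iff finite_subset subsetI)

lemma card_edge: "e \<in> E \<Longrightarrow> card e = 2"
  using simple by (simp add: simple_finite_graph_def)

lemma finite_edges: "F \<subseteq> E \<Longrightarrow> finite F"
  using finite_E finite_subset by blast

lemma finite_vertices: "F \<subseteq> E \<Longrightarrow> finite (\<Union>F)"
  using finite_edges card_edge by (intro finite_Union_edges) auto

lemma even_tree_empty: "D \<subseteq> B \<Longrightarrow> even_edges D \<Longrightarrow> D = {}"
  using basis card_edge finite_edges forest_subset
  by (intro even_forest_empty) (auto intro: finite_edges)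

text \<open>The nonempty even subset of \<open>insert i B\<close> is unique, and every dependent subset contains it. So
  it is the only circuit there.\<close>

lemma fundamental_circuit_even:
  assumes i: "i \<in> E - B"
  shows "C i \<subseteq> insert i B" "even_edges (C i)" "i \<in> C i"
proof -
  have sub: "insert i B \<subseteq> E" using i basis by auto
  obtain D where D: "D \<subseteq> insert i B" "finite D" "D \<noteq> {}" "even_edges D"
    using cycle_contains_even[OF spanning[OF i]] by metis
  have unique: "D' = D" if "D' \<subseteq> insert i B" "even_edges D'" "D' \<noteq> {}" for D'
    using even_edges_unique[of B i D' D] that D basis card_edge finite_edges i by blast
  have nonforest: "D \<subseteq> F" if "F \<subseteq> insert i B" "\<not> forest F" for F
    using cycle_contains_even[OF that(2)] unique that(1) by (metis subset_trans)
  have nf: "\<not> forest D"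
    using even_forest_empty[of D] D card_edge sub by blast
  have "circuit M D"
    unfolding circuit_def
  proof (intro conjI allI impI)
    fix X assume X: "X \<subset> D"
    then have "forest X" using nonforest[of X] D(1) by blast
    then show "indep M X" using X D(1) sub by auto
  qed (use D(1) sub nf in auto)
  moreover have "X = D" if "circuit M X" "X \<subseteq> insert i B" for X
  proof -
    have "\<not> forest X" using that(1) by (auto simp: circuit_def)
    then have "D \<subseteq> X" using nonforest that by auto
    then show ?thesis using that(1) nf by (auto simp: circuit_def)
  qed
  ultimately have "C i = D"
    unfolding fundamental_circuit_def using D(1) by (intro the_equality) blast+
  moreover have "i \<in> D"
    using even_tree_empty[of D] D by auto
  ultimately show "C i \<subseteq> insert i B" "even_edges (C i)" "i \<in> C i" using D by auto
qed

text \<open>An even set is the sum modulo two of the fundamental circuits of its nontree edges, so one of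
  these covers \<open>e\<close>. The induction adds one fundamental circuit at a time until only tree edges would
  be left.\<close>

lemma even_edges_tree_edge_covered:
  assumes "D \<subseteq> E" "even_edges D" "e \<in> D \<inter> B"
  shows "\<exists>i\<in>D - B. e \<in> C i"
  using assms
proof (induction "card (D - B)" arbitrary: D rule: less_induct)
  case less
  have "D - B \<noteq> {}" using even_tree_empty[of D] less.prems by auto
  then obtain i where i: "i \<in> D" "i \<notin> B" by auto
  then have iE: "i \<in> E - B" using less.prems by auto
  note Ci = fundamental_circuit_even[OF iE]
  have CE: "C i \<subseteq> E" using Ci(1) iE basis by auto
  show ?case
  proof (cases "e \<in> C i")
    case True then show ?thesis using i by auto
  next
    case False
    let ?D = "sym_diff D (C i)"
    have eq: "?D - B = (D - B) - {i}" using Ci i by auto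
    have "card (?D - B) < card (D - B)"
      unfolding eq using i less.prems(1) finite_edges[of "D - B"] by (intro card_Diff1_less) auto
    moreover have "?D \<subseteq> E" using CE less.prems by auto
    moreover have "even_edges ?D"
      using less.prems CE Ci finite_edges by (intro even_edges_sym_diff) auto
    moreover have "e \<in> ?D \<inter> B" using False less.prems by auto
    ultimately have "\<exists>i\<in>?D - B. e \<in> C i" using less.hyps by blast
    then show ?thesis using eq by auto
  qed
qed

lemma card_eq_1_iff_ex1: "card X = 1 \<longleftrightarrow> (\<exists>!x. x \<in> X)"
proof
  assume "card X = 1"
  then obtain x where "X = {x}" by (rule card_1_singletonE)
  then show "\<exists>!x. x \<in> X" by simp
next
  assume "\<exists>!x. x \<in> X"
  then obtain x where "X = {x}" by blast
  then show "card X = 1" by simp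
qed

lemma U_iff: "e \<in> U \<sigma> \<longleftrightarrow> e \<in> E \<and> (\<exists>!i. i \<in> \<sigma> \<and> e \<in> C i)"
proof -
  have "card {i \<in> \<sigma>. e \<in> C i} = 1 \<longleftrightarrow> (\<exists>!i. i \<in> \<sigma> \<and> e \<in> C i)"
    using card_eq_1_iff_ex1[of "{i \<in> \<sigma>. e \<in> C i}"] by simp
  then show ?thesis by (simp add: once_covered_def multiplicity_in_def)
qed

lemma U_unique:
  assumes "e \<in> U \<sigma>" "i \<in> \<sigma>" "e \<in> C i" "j \<in> \<sigma>" "e \<in> C j"
  shows "i = j"
  using assms U_iff by blast

lemma U_subset_E: "U \<sigma> \<subseteq> E"
  by (auto simp: once_covered_def)

lemma A_subset_E: "A \<sigma> \<subseteq> E"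
  by (auto simp: covered_def)

lemma A_iff:
  assumes "\<sigma> \<subseteq> E"
  shows "e \<in> A \<sigma> \<longleftrightarrow> e \<in> E \<and> (\<exists>i\<in>\<sigma>. e \<in> C i)"
proof -
  have "finite \<sigma>" using assms finite_edges by auto
  then have "Suc 0 \<le> card {i \<in> \<sigma>. e \<in> C i} \<longleftrightarrow> (\<exists>i\<in>\<sigma>. e \<in> C i)"
    by (auto simp: Suc_le_eq card_gt_0_iff)
  then show ?thesis by (simp add: covered_def multiplicity_in_def)
qed

lemma U_subset_A: "\<sigma> \<subseteq> E \<Longrightarrow> U \<sigma> \<subseteq> A \<sigma>"
  by (auto simp: U_iff A_iff)

lemma nontree_in_circuit: "i \<in> E - B \<Longrightarrow> e \<notin> B \<Longrightarrow> e \<in> C i \<longleftrightarrow> e = i"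
  using fundamental_circuit_even[of i] by auto

lemma U_nontree:
  assumes "\<sigma> \<subseteq> E - B"
  shows "U \<sigma> - B = \<sigma>"
proof -
  have "e \<in> \<sigma>" if "e \<in> U \<sigma>" "e \<notin> B" for e
    using that assms nontree_in_circuit by (auto simp: U_iff)
  moreover have "e \<in> U \<sigma>" if e: "e \<in> \<sigma>" for e
  proof -
    have "e \<in> E" "e \<notin> B" using e assms by auto
    then have "i \<in> \<sigma> \<and> e \<in> C i \<longleftrightarrow> i = e" for i
      using nontree_in_circuit[of i e] e assms by blast
    then show ?thesis using \<open>e \<in> E\<close> by (simp add: U_iff)
  qed
  ultimately show ?thesis using assms by auto
qed

lemma A_nontree:
  assumes "\<sigma> \<subseteq> E - B"
  shows "A \<sigma> - B = \<sigma>"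
proof -
  have "e \<in> \<sigma>" if "e \<in> A \<sigma>" "e \<notin> B" for e
    using that assms nontree_in_circuit by (subst (asm) A_iff) blast+
  then show ?thesis using U_nontree[OF assms] U_subset_A[of \<sigma>] assms by auto
qed

text \<open>Here the shape of the tree enters. The multiplicity of the tree edge at a leaf \<open>v\<close> equals the
  number of edges of \<open>\<sigma>\<close> ending at \<open>v\<close>. If this number is one, the tree edge itself is covered
  once and supplies the second edge of \<open>U \<sigma>\<close> at \<open>v\<close>.\<close>

lemma vdeg_once_covered:
  assumes \<sigma>: "\<sigma> \<subseteq> E - B" and v: "v \<notin> S" "v \<in> \<Union>(A \<sigma>)"
  shows "2 \<le> vdeg (U \<sigma>) v"
proof -
  have fU: "finite (U \<sigma>)" by (rule finite_edges[OF U_subset_E])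
  have fB: "finite {e \<in> B. v \<in> e}" using basis finite_edges by auto
  have deg_circuit: "vdeg (C i) v \<noteq> 1" if "i \<in> \<sigma>" for i
    using fundamental_circuit_even(2)[of i] that \<sigma> by (metis even_edges_def odd_one subsetD)
  have one: "g = g'" if "g \<in> B" "v \<in> g" "g' \<in> B" "v \<in> g'" for g g'
  proof -
    have "card {e \<in> B. v \<in> e} \<le> Suc 0" using inner(3)[OF v(1)] by (simp add: vdeg_def)
    then show ?thesis using that card_le_Suc0_iff_eq[OF fB] by blast
  qed
  \<comment> \<open>The degree of \<open>v\<close> in \<open>C i\<close> is not one, and only \<open>i\<close> and \<open>g\<close> can be edges of \<open>C i\<close> at \<open>v\<close>.\<close>
  have via: "v \<in> i \<longleftrightarrow> g \<in> C i" if "i \<in> \<sigma>" "g \<in> B" "v \<in> g" for i g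
  proof -
    have Ci: "C i \<subseteq> insert i B" "i \<in> C i"
      using fundamental_circuit_even[of i] that \<sigma> by auto
    show ?thesis
    proof
      assume "v \<in> i"
      show "g \<in> C i"
      proof (rule ccontr)
        assume "g \<notin> C i"
        then have "{e \<in> C i. v \<in> e} = {i}" using Ci one[OF that(2,3)] \<open>v \<in> i\<close> by blast
        then show False using deg_circuit[OF that(1)] by (simp add: vdeg_def)
      qed
    next
      assume "g \<in> C i"
      show "v \<in> i"
      proof (rule ccontr)
        assume "v \<notin> i"
        then have "{e \<in> C i. v \<in> e} = {g}"
          using Ci one[OF that(2,3)] \<open>g \<in> C i\<close> that(2,3) by blast
        then show False using deg_circuit[OF that(1)] by (simp add: vdeg_def)
      qed
    qed
  qed
  have "\<sigma> \<subseteq> E" using \<sigma> by blast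
  then obtain e i where e: "e \<in> E" "v \<in> e" "i \<in> \<sigma>" "e \<in> C i"
    using v(2) A_iff by blast
  have iE: "i \<in> E - B" using e \<sigma> by auto
  have vi: "v \<in> i"
    using via[of i e] e nontree_in_circuit[OF iE, of e] by auto
  have iU: "i \<in> U \<sigma>" using U_nontree[OF \<sigma>] e(3) by auto
  have "\<exists>f\<in>U \<sigma>. v \<in> f \<and> f \<noteq> i"
  proof (cases "\<exists>j\<in>\<sigma>. v \<in> j \<and> j \<noteq> i")
    case True then show ?thesis using U_nontree[OF \<sigma>] by auto
  next
    case False
    have "\<exists>g\<in>C i. v \<in> g \<and> g \<noteq> i"
    proof (rule ccontr)
      assume "\<not> ?thesis"
      then have "{e \<in> C i. v \<in> e} = {i}"
        using vi fundamental_circuit_even(3)[OF iE] by auto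
      then show False using deg_circuit[OF e(3)] by (simp add: vdeg_def)
    qed
    then obtain g where g: "g \<in> C i" "v \<in> g" "g \<noteq> i" by auto
    then have gB: "g \<in> B" using fundamental_circuit_even(1)[OF iE] by auto
    have "j \<in> \<sigma> \<and> g \<in> C j \<longleftrightarrow> j = i" for j
      using False via[OF _ gB g(2)] g(1) e(3) by blast
    then have "g \<in> U \<sigma>" using gB basis(1) by (auto simp: U_iff)
    then show ?thesis using g by auto
  qed
  then obtain f where f: "f \<in> U \<sigma>" "v \<in> f" "f \<noteq> i" by auto
  have "card {i, f} \<le> vdeg (U \<sigma>) v"
    unfolding vdeg_def using f iU vi fU by (intro card_mono) auto
  then show ?thesis using f by simp
qed

lemma dead_iff: "dead M B \<sigma> \<longleftrightarrow> \<sigma> \<noteq> {} \<and> \<sigma> \<subseteq> E - B \<and> forest (U \<sigma>)"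
  by (auto simp: dead_def stratum_def U_iff)

lemma dead_vertex_bound:
  assumes "dead M B \<sigma>"
  shows "card (\<Union>(A \<sigma>)) \<le> card (U \<sigma>) + 2"
    and "card (\<Union>(A \<sigma>)) = card (U \<sigma>) + 2
      \<Longrightarrow> \<forall>v\<in>\<Union>(U \<sigma>). vdeg (U \<sigma>) v = (if v \<in> S then 1 else 2)"
proof -
  have \<sigma>: "\<sigma> \<noteq> {}" "\<sigma> \<subseteq> E - B" "forest (U \<sigma>)" using assms by (auto simp: dead_iff)
  note UE = U_subset_E[of \<sigma>]
  note AE = A_subset_E[of \<sigma>]
  have UA: "\<Union>(U \<sigma>) \<subseteq> \<Union>(A \<sigma>)" using U_subset_A[of \<sigma>] \<sigma>(2) by blast
  have ne: "U \<sigma> \<noteq> {}" using U_nontree[OF \<sigma>(2)] \<sigma>(1) by auto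
  have c2: "\<forall>e\<in>U \<sigma>. card e = 2" using card_edge UE by auto
  have d: "\<forall>v\<in>\<Union>(A \<sigma>) - S. 2 \<le> vdeg (U \<sigma>) v" using vdeg_once_covered[OF \<sigma>(2)] by blast
  note * = forest_ends_bound[OF finite_edges[OF UE] c2 ne \<sigma>(3) finite_vertices[OF AE] UA
      inner(1,2) d]
  show "card (\<Union>(A \<sigma>)) \<le> card (U \<sigma>) + 2" by (rule *(1))
  show "card (\<Union>(A \<sigma>)) = card (U \<sigma>) + 2
      \<Longrightarrow> \<forall>v\<in>\<Union>(U \<sigma>). vdeg (U \<sigma>) v = (if v \<in> S then 1 else 2)" by (rule *(2))
qed

text \<open>As \<open>U \<sigma>\<close> is independent, it is the only basis of itself, which removes the choice of a basis
  from the definition of the contraction.\<close>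

lemma indep_dead_node:
  assumes "dead M B \<sigma>"
  shows "ground (dead_node M B \<sigma>) = A \<sigma> - U \<sigma>"
    and "indep (dead_node M B \<sigma>) I \<longleftrightarrow> I \<subseteq> A \<sigma> - U \<sigma> \<and> forest (I \<union> U \<sigma>)"
proof -
  have \<sigma>: "\<sigma> \<subseteq> E" "forest (U \<sigma>)" using assms by (auto simp: dead_iff)
  note AE = A_subset_E[of \<sigma>]
  have UA: "U \<sigma> \<subseteq> A \<sigma>" by (rule U_subset_A[OF \<sigma>(1)])
  have "E \<inter> A \<sigma> = A \<sigma>" "A \<sigma> \<inter> U \<sigma> = U \<sigma>" using AE UA by auto
  then show "ground (dead_node M B \<sigma>) = A \<sigma> - U \<sigma>"
    by (simp add: dead_node_def contraction_def restriction_def)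
  have indU: "indep (restriction M (A \<sigma>)) (U \<sigma>)"
    using AE UA \<sigma>(2) by (auto simp: restriction_def)
  have "basis_of (restriction M (A \<sigma>)) (U \<sigma>) J \<longleftrightarrow> J = U \<sigma>" for J
  proof
    assume J: "basis_of (restriction M (A \<sigma>)) (U \<sigma>) J"
    then have "J \<subseteq> U \<sigma>" "\<not> J \<subset> U \<sigma>" using indU unfolding basis_of_def by blast+
    then show "J = U \<sigma>" by blast
  qed (use indU in \<open>auto simp: basis_of_def\<close>)
  then show "indep (dead_node M B \<sigma>) I \<longleftrightarrow> I \<subseteq> A \<sigma> - U \<sigma> \<and> forest (I \<union> U \<sigma>)"
    using AE UA \<open>E \<inter> A \<sigma> = A \<sigma>\<close> \<open>A \<sigma> \<inter> U \<sigma> = U \<sigma>\<close>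
    by (auto simp: dead_node_def contraction_def) (auto simp: restriction_def)
qed

lemma card_forest_in_covered:
  assumes "\<sigma> \<subseteq> E" "F \<subseteq> A \<sigma>" "F \<noteq> {}" "forest F"
  shows "card F < card (\<Union>(A \<sigma>))"
proof -
  note AE = A_subset_E[of \<sigma>]
  have "card F < card (\<Union>F)"
    using assms AE finite_edges card_edge by (intro forest_card_less_vertices) auto
  also have "\<dots> \<le> card (\<Union>(A \<sigma>))"
    using assms(2) finite_vertices[OF AE] by (intro card_mono) auto
  finally show ?thesis .
qed

text \<open>\<open>I \<union> U \<sigma>\<close> is a forest on the vertices of \<open>A \<sigma>\<close>, so
  \<open>|I| + |U \<sigma>| < |V(A \<sigma>)| \<le> |U \<sigma>| + 2\<close>.\<close>

lemma indep_dead_node_card: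
  assumes "dead M B \<sigma>" "indep (dead_node M B \<sigma>) I"
  shows "card I \<le> 1"
proof -
  have \<sigma>: "\<sigma> \<noteq> {}" "\<sigma> \<subseteq> E - B" using assms by (auto simp: dead_iff)
  have I: "I \<subseteq> A \<sigma> - U \<sigma>" "forest (I \<union> U \<sigma>)" using assms indep_dead_node by auto
  have UA: "U \<sigma> \<subseteq> A \<sigma>" using U_subset_A \<sigma>(2) by auto
  note AE = A_subset_E[of \<sigma>]
  have "card (I \<union> U \<sigma>) < card (\<Union>(A \<sigma>))"
    using \<sigma> I UA U_nontree[OF \<sigma>(2)] by (intro card_forest_in_covered) auto
  moreover have "card (I \<union> U \<sigma>) = card I + card (U \<sigma>)"
    using I UA AE by (intro card_Un_disjoint) (auto intro: finite_edges)
  ultimately show ?thesis using dead_vertex_bound(1)[OF assms(1)] by linarith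
qed

text \<open>The tree edges in \<open>A \<sigma>\<close> form a forest, so there are at most \<open>|V(A \<sigma>)| - 1 \<le> |U \<sigma>| + 1\<close> of them,
  and the other edges of \<open>A \<sigma>\<close> are those of \<open>\<sigma>\<close>.\<close>

lemma card_multiply_covered:
  assumes "dead M B \<sigma>"
  shows "card (A \<sigma> - U \<sigma>) \<le> card \<sigma> + 1"
proof -
  have \<sigma>: "\<sigma> \<noteq> {}" "\<sigma> \<subseteq> E - B" using assms by (auto simp: dead_iff)
  have UA: "U \<sigma> \<subseteq> A \<sigma>" using U_subset_A \<sigma>(2) by auto
  note AE = A_subset_E[of \<sigma>]
  note fin = finite_edges[OF AE]
  have "card (A \<sigma> \<inter> B) < card (\<Union>(A \<sigma>))"
  proof (cases "A \<sigma> \<inter> B = {}")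
    case True
    have "A \<sigma> \<noteq> {}" using A_nontree[OF \<sigma>(2)] \<sigma>(1) by auto
    then have "\<Union>(A \<sigma>) \<noteq> {}" using AE card_edge by fastforce
    then show ?thesis using True finite_vertices[OF AE] by (simp add: card_gt_0_iff)
  next
    case False
    then show ?thesis
      using \<sigma> forest_subset[OF basis(2), of "A \<sigma> \<inter> B"] by (intro card_forest_in_covered) auto
  qed
  moreover have "card (A \<sigma>) = card (A \<sigma> \<inter> B) + card \<sigma>"
    using card_Int_Diff[OF fin, of B] A_nontree[OF \<sigma>(2)] by simp
  moreover have "card (A \<sigma> - U \<sigma>) = card (A \<sigma>) - card (U \<sigma>)"
    using UA fin finite_subset by (intro card_Diff_subset) auto
  ultimately show ?thesis using dead_vertex_bound(1)[OF assms] by linarith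
qed

text \<open>An edge of \<open>C i\<close> that no other element of \<open>\<sigma>\<close> covers is not covered by another element of \<open>\<tau>\<close>
  either. So baselines can only grow when passing to a subset, which is why firing from a baseline
  forces equality.\<close>

lemma U_anti_mono:
  assumes "\<tau> \<subseteq> \<sigma>" "i \<in> \<tau>"
  shows "C i \<inter> U \<sigma> \<subseteq> C i \<inter> U \<tau>"
proof
  fix e assume e: "e \<in> C i \<inter> U \<sigma>"
  have "j = i" if "j \<in> \<tau>" "e \<in> C j" for j
    using that assms e U_unique[of e \<sigma> j i] by blast
  then have "\<exists>!j. j \<in> \<tau> \<and> e \<in> C j" using e assms(2) by blast
  then show "e \<in> C i \<inter> U \<tau>" using e U_iff by blast
qed

text \<open>A nonloop \<open>e\<close> of the dead node makes the vertex bound sharp, so \<open>U \<sigma>\<close> is a path with both ends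
  in \<open>S\<close>. Since \<open>U \<tau>\<close> satisfies the same degree bounds, rigidity gives \<open>U \<tau> = U \<sigma>\<close>, and the
  nontree edges on both sides are \<open>\<tau>\<close> and \<open>\<sigma>\<close>.\<close>

lemma no_proper_U_subset:
  assumes "dead M B \<sigma>" "\<tau> \<noteq> {}" "\<tau> \<subset> \<sigma>"
    and e: "indep (dead_node M B \<sigma>) {e}"
  shows "\<not> U \<tau> \<subseteq> U \<sigma>"
proof
  assume sub: "U \<tau> \<subseteq> U \<sigma>"
  have \<sigma>: "\<sigma> \<subseteq> E - B" "forest (U \<sigma>)" using assms by (auto simp: dead_iff)
  then have \<tau>: "\<tau> \<subseteq> E - B" using assms by auto
  note UE = U_subset_E[of \<sigma>]
  have e': "e \<in> A \<sigma> - U \<sigma>" "forest (insert e (U \<sigma>))"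
    using e indep_dead_node[OF assms(1)] by auto
  have "card (insert e (U \<sigma>)) < card (\<Union>(A \<sigma>))"
    using \<sigma> e' U_subset_A[of \<sigma>] by (intro card_forest_in_covered) auto
  then have "card (\<Union>(A \<sigma>)) = card (U \<sigma>) + 2"
    using dead_vertex_bound(1)[OF assms(1)] e' finite_edges[OF UE] by simp
  then have deg: "\<forall>v\<in>\<Union>(U \<sigma>). vdeg (U \<sigma>) v = (if v \<in> S then 1 else 2)"
    by (rule dead_vertex_bound(2)[OF assms(1)])
  have c2: "\<forall>e\<in>U \<sigma>. card e = 2" using card_edge UE by auto
  have ne: "U \<tau> \<noteq> {}" using U_nontree[OF \<tau>] assms(2) by auto
  have "\<forall>v\<in>\<Union>(U \<tau>) - S. 2 \<le> vdeg (U \<tau>) v"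
    using vdeg_once_covered[OF \<tau>] U_subset_A[of \<tau>] \<tau> by blast
  then have "U \<tau> = U \<sigma>"
    by (rule forest_two_ends_rigid[OF finite_edges[OF UE] c2 \<sigma>(2) deg inner(1,2) sub ne])
  then have "\<tau> = \<sigma>" using U_nontree[OF \<tau>] U_nontree[OF \<sigma>(1)] by metis
  then show False using assms(3) by blast
qed

text \<open>The edge \<open>i\<close> is taken on the unique circuit \<open>Z\<close> of \<open>insert e (U \<sigma>)\<close>. It exists because the
  fundamental circuits of the nontree edges of \<open>Z\<close> add up to \<open>Z\<close>, which contains the tree edge
  \<open>e\<close>.\<close>

lemma loop_witness:
  assumes "dead M B \<sigma>" "e \<in> A \<sigma> - U \<sigma>" "\<not> forest (insert e (U \<sigma>))"
  shows "\<exists>i\<in>\<sigma>. e \<in> C i \<and> (\<forall>W. W \<subseteq> insert e (U \<sigma>) \<and> \<not> forest W \<longrightarrow> i \<in> W)"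
proof -
  have \<sigma>: "\<sigma> \<subseteq> E - B" "forest (U \<sigma>)" using assms by (auto simp: dead_iff)
  note UE = U_subset_E[of \<sigma>]
  have eE: "e \<in> E" using assms(2) A_subset_E by blast
  have eB: "e \<in> B" using assms(2) A_nontree[OF \<sigma>(1)] U_nontree[OF \<sigma>(1)] by blast
  obtain Z where Z: "Z \<subseteq> insert e (U \<sigma>)" "finite Z" "Z \<noteq> {}" "even_edges Z"
    using cycle_contains_even[OF assms(3)] by metis
  have unique: "Z \<subseteq> W" if W: "W \<subseteq> insert e (U \<sigma>)" "\<not> forest W" for W
  proof -
    obtain D where D: "D \<subseteq> W" "D \<noteq> {}" "even_edges D"
      using cycle_contains_even[OF W(2)] by metis
    have "D \<subseteq> insert e (U \<sigma>)" using D(1) W(1) by blast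
    then have "Z = D"
      using finite_edges[OF UE] card_edge UE eE \<sigma>(2) Z D(2,3)
      by (intro even_edges_unique[of "U \<sigma>" e Z D]) blast+
    then show ?thesis using D by simp
  qed
  have eZ: "e \<in> Z"
  proof (rule ccontr)
    assume "e \<notin> Z"
    then have "Z \<subseteq> U \<sigma>" using Z by auto
    then have "forest Z" using \<sigma>(2) forest_subset by blast
    moreover have "\<forall>e\<in>Z. card e = 2" using \<open>Z \<subseteq> U \<sigma>\<close> UE card_edge by auto
    ultimately show False using even_forest_empty Z by blast
  qed
  obtain i where i: "i \<in> Z - B" "e \<in> C i"
    using even_edges_tree_edge_covered[of Z e] Z UE eE eZ eB by blast
  then have "i \<in> \<sigma>" using Z(1) eB U_nontree[OF \<sigma>(1)] by blast
  then show ?thesis using i unique by blast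
qed

lemma baseline_U: "i \<in> \<tau> \<Longrightarrow> baseline M B \<tau> i = card (C i \<inter> U \<tau>)"
  by (simp add: baseline_def)

lemma finite_CU: "finite (C i \<inter> U \<tau>)"
  using finite_edges[OF U_subset_E] by blast

lemma baseline_anti_mono: "\<tau> \<subseteq> \<sigma> \<Longrightarrow> i \<in> \<tau> \<Longrightarrow> baseline M B \<sigma> i \<le> baseline M B \<tau> i"
  using card_mono[OF finite_CU U_anti_mono, of \<tau> \<sigma> i] by (auto simp: baseline_U)

lemma U_subset_if_baseline:
  assumes "\<tau> \<subseteq> \<sigma>" "\<And>i. i \<in> \<tau> \<Longrightarrow> e \<in> C i \<Longrightarrow> baseline M B \<tau> i \<le> baseline M B \<sigma> i"
    and "e \<in> U \<tau>"
  shows "e \<in> U \<sigma>"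
proof -
  obtain i where i: "i \<in> \<tau>" "e \<in> C i" using assms(3) U_iff by blast
  have "card (C i \<inter> U \<tau>) \<le> card (C i \<inter> U \<sigma>)"
    using assms(2)[OF i] i assms(1) by (auto simp: baseline_U)
  then have "C i \<inter> U \<sigma> = C i \<inter> U \<tau>"
    using U_anti_mono[OF assms(1) i(1)] finite_CU by (intro card_seteq) auto
  then show ?thesis using i assms(3) by auto
qed

lemma dead_node_rank: "dead M B \<sigma> \<Longrightarrow> rank (dead_node M B \<sigma>) \<le> 1"
  and dead_node_h_vector: "dead M B \<sigma> \<Longrightarrow> h_vector (dead_node M B \<sigma>) k
    = (if k = 0 then 1
       else if k = 1 then int (card {e \<in> A \<sigma> - U \<sigma>. forest (insert e (U \<sigma>))} - 1) else 0)"
proof -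
  assume d: "dead M B \<sigma>"
  let ?K = "dead_node M B \<sigma>"
  note AE = A_subset_E[of \<sigma>]
  note K = indep_dead_node[OF d]
  have fin: "finite (ground ?K)" using K(1) finite_edges[OF AE] by simp
  have empty: "indep ?K {}" using d by (simp add: K dead_iff)
  have small: "I \<subseteq> ground ?K \<and> card I \<le> 1" if "indep ?K I" for I
    using that K indep_dead_node_card[OF d] by auto
  have "{e \<in> ground ?K. indep ?K {e}} = {e \<in> A \<sigma> - U \<sigma>. forest (insert e (U \<sigma>))}"
    using K by auto
  then show "h_vector ?K k
    = (if k = 0 then 1
       else if k = 1 then int (card {e \<in> A \<sigma> - U \<sigma>. forest (insert e (U \<sigma>))} - 1) else 0)"
    using rank_le_one_h_vector(2)[OF fin empty small, of k] by simp
  show "rank ?K \<le> 1" by (rule rank_le_one_h_vector(1)[OF fin empty small])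
qed

lemma fire_from_baseline:
  assumes "dead M B \<sigma>" "\<tau> \<noteq> {}" "\<tau> \<subseteq> \<sigma>"
    and "\<And>i. i \<in> \<tau> \<Longrightarrow> baseline M B \<tau> i \<le> baseline M B \<sigma> i"
  shows "U \<tau> \<subseteq> U \<sigma>" "dead M B \<tau>" "\<And>i. i \<in> \<tau> \<Longrightarrow> baseline M B \<sigma> i = baseline M B \<tau> i"
proof -
  show sub: "U \<tau> \<subseteq> U \<sigma>" using U_subset_if_baseline assms(3,4) by blast
  show "dead M B \<tau>" using assms(1-3) forest_subset[OF _ sub] by (auto simp: dead_iff)
  show "\<And>i. i \<in> \<tau> \<Longrightarrow> baseline M B \<sigma> i = baseline M B \<tau> i"
    using baseline_anti_mono[OF assms(3)] assms(4) by (simp add: le_antisym)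
qed

text \<open>Some edge \<open>e\<close> lies in \<open>U \<tau>\<close> but not in \<open>U \<sigma>\<close>, and one unit at \<open>j\<close> pays for just one such edge,
  on \<open>C j\<close>. If \<open>U \<tau>\<close> were dependent, the witness \<open>i \<noteq> j\<close> for the loop \<open>e\<close> would belong to \<open>\<tau>\<close>, and
  \<open>e\<close> would be covered by both \<open>i\<close> and \<open>j\<close>. For which \<open>j\<close> the witness assumption holds is decided
  by counting in \<open>dead_unconditional_fibre\<close>.\<close>

lemma fire_from_unit:
  assumes d: "dead M B \<sigma>" and \<tau>: "\<tau> \<noteq> {}" "\<tau> \<subset> \<sigma>"
    and n: "indep (dead_node M B \<sigma>) {n}"
    and fire: "can_fire M B \<tau> (\<lambda>i. baseline M B \<sigma> i + unit_exponent j i)"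
    and witness: "\<And>e. e \<in> A \<sigma> - U \<sigma> \<Longrightarrow> \<not> forest (insert e (U \<sigma>)) \<Longrightarrow>
      \<exists>i\<in>\<sigma>. i \<noteq> j \<and> e \<in> C i \<and> (\<forall>W. W \<subseteq> insert e (U \<sigma>) \<and> \<not> forest W \<longrightarrow> i \<in> W)"
  shows "dead M B \<tau>" "\<And>i. i \<in> \<tau> \<Longrightarrow> baseline M B \<sigma> i + unit_exponent j i = baseline M B \<tau> i"
proof -
  have \<sigma>: "\<sigma> \<subseteq> E - B" "\<tau> \<subseteq> E - B" using d \<tau> by (auto simp: dead_iff)
  have sub: "\<tau> \<subseteq> \<sigma>" using \<tau> by auto
  have fire': "baseline M B \<tau> i \<le> baseline M B \<sigma> i + unit_exponent j i" if "i \<in> \<tau>" for i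
    using fire that by (simp add: can_fire_def)
  have other: "baseline M B \<tau> i \<le> baseline M B \<sigma> i" if "i \<in> \<tau>" "i \<noteq> j" for i
    using fire'[OF that(1)] that(2) by (simp add: unit_exponent_def)
  obtain e where e: "e \<in> U \<tau>" "e \<notin> U \<sigma>" using no_proper_U_subset[OF d \<tau> n] by auto
  have j: "j \<in> \<tau>" "e \<in> C j"
    using U_subset_if_baseline[OF sub _ e(1)] e(2) other by blast+
  let ?X = "insert e (C j \<inter> U \<sigma>)"
  have Xsub: "?X \<subseteq> C j \<inter> U \<tau>" using U_anti_mono[OF sub j(1)] e(1) j(2) by auto
  have cX: "card ?X = baseline M B \<sigma> j + 1"
    using j(1) sub e(2) finite_CU[of j \<sigma>] by (auto simp: baseline_U)
  have "card (C j \<inter> U \<tau>) \<le> baseline M B \<sigma> j + 1"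
    using fire'[OF j(1)] j(1) by (simp add: unit_exponent_def baseline_U)
  then have X: "?X = C j \<inter> U \<tau>"
    using Xsub cX finite_CU by (intro card_seteq) auto
  then have bj: "baseline M B \<tau> j = baseline M B \<sigma> j + 1"
    using j(1) cX by (simp add: baseline_U)
  show "baseline M B \<sigma> i + unit_exponent j i = baseline M B \<tau> i" if "i \<in> \<tau>" for i
    using bj other[OF that] baseline_anti_mono[OF sub that]
    by (cases "i = j") (simp_all add: unit_exponent_def)
  have U\<tau>: "U \<tau> \<subseteq> insert e (U \<sigma>)"
  proof
    fix f assume f: "f \<in> U \<tau>"
    show "f \<in> insert e (U \<sigma>)"
    proof (cases "f \<in> C j")
      case True then show ?thesis using f X by auto
    next
      case False
      then show ?thesis using U_subset_if_baseline[OF sub _ f] other by blast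
    qed
  qed
  have "\<sigma> \<subseteq> E" using \<sigma>(1) by blast
  then have eA: "e \<in> A \<sigma> - U \<sigma>" using A_iff e j sub U_subset_E by blast
  have "forest (U \<tau>)"
  proof (rule ccontr)
    assume nf: "\<not> forest (U \<tau>)"
    then have "\<not> forest (insert e (U \<sigma>))" using forest_subset[OF _ U\<tau>] by auto
    then obtain i where i: "i \<in> \<sigma>" "i \<noteq> j" "e \<in> C i" "i \<in> U \<tau>"
      using witness[OF eA] nf U\<tau> by blast
    have "i \<in> \<tau>" using i \<sigma> U_nontree[OF \<sigma>(2)] by auto
    then show False using U_unique[OF e(1)] i(2,3) j by blast
  qed
  then show "dead M B \<tau>" using \<sigma> \<tau> by (simp add: dead_iff)
qed

lemma dead_unconditional_fibre:
  assumes d: "dead M B \<sigma>"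
  shows "\<exists>F. unconditional_fibre M B \<sigma> F"
proof -
  have \<sigma>: "\<sigma> \<subseteq> E - B" using d by (auto simp: dead_iff)
  have f\<sigma>: "finite \<sigma>" using finite_edges[of \<sigma>] \<sigma> by auto
  note AE = A_subset_E[of \<sigma>]
  define N where "N = {e \<in> A \<sigma> - U \<sigma>. forest (insert e (U \<sigma>))}"
  define L where "L = {e \<in> A \<sigma> - U \<sigma>. \<not> forest (insert e (U \<sigma>))}"
  have fin: "finite N" "finite L" using finite_edges[OF AE] by (auto simp: N_def L_def)
  have "card N + card L = card (N \<union> L)"
    using fin by (subst card_Un_disjoint) (auto simp: N_def L_def)
  also have "N \<union> L = A \<sigma> - U \<sigma>" by (auto simp: N_def L_def)
  finally have NL: "card N + card L \<le> card \<sigma> + 1" using card_multiply_covered[OF d] by simp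
  have "\<exists>i. i \<in> \<sigma> \<and> e \<in> C i \<and> (\<forall>W. W \<subseteq> insert e (U \<sigma>) \<and> \<not> forest W \<longrightarrow> i \<in> W)"
    if "e \<in> L" for e
    using loop_witness[OF d, of e] that unfolding L_def by blast
  then obtain f where f: "\<And>e. e \<in> L \<Longrightarrow> f e \<in> \<sigma> \<and> e \<in> C (f e) \<and>
      (\<forall>W. W \<subseteq> insert e (U \<sigma>) \<and> \<not> forest W \<longrightarrow> f e \<in> W)"
    by metis
  \<comment> \<open>The units to avoid are those at \<open>f e\<close> for the loops \<open>e\<close>; enough others remain.\<close>
  have "card (f ` L) \<le> card L" using fin by (intro card_image_le)
  moreover have "card (\<sigma> - f ` L) = card \<sigma> - card (f ` L)"
    using f fin by (intro card_Diff_subset) auto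
  ultimately have "card N - 1 \<le> card (\<sigma> - f ` L)" using NL by linarith
  then obtain J where J: "J \<subseteq> \<sigma> - f ` L" "card J = card N - 1" "finite J"
    by (meson obtain_subset_with_card_n)
  let ?F = "insert (\<lambda>_. 0) (unit_exponent ` J)"
  have J\<sigma>: "J \<subseteq> \<sigma>" using J by auto
  have "dead M B \<tau> \<and> (\<forall>i\<in>\<tau>. baseline M B \<sigma> i + m i = baseline M B \<tau> i)"
    if m: "m \<in> ?F" and \<tau>: "\<tau> \<noteq> {}" "\<tau> \<subset> \<sigma>"
      and fire: "can_fire M B \<tau> (\<lambda>i. baseline M B \<sigma> i + m i)" for m \<tau>
  proof (cases "m = (\<lambda>_. 0)")
    case True
    have "baseline M B \<tau> i \<le> baseline M B \<sigma> i" if "i \<in> \<tau>" for i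
      using fire that True by (auto simp: can_fire_def)
    then show ?thesis using fire_from_baseline[OF d \<tau>(1)] \<tau>(2) True by auto
  next
    case False
    then obtain j where j: "j \<in> J" "m = unit_exponent j" using m by auto
    then have "0 < card J" using J(3) card_gt_0_iff by blast
    then have "N \<noteq> {}" using J(2) by auto
    then obtain n where "n \<in> N" by auto
    then have n: "indep (dead_node M B \<sigma>) {n}" by (auto simp: indep_dead_node[OF d] N_def)
    have witness: "\<exists>i\<in>\<sigma>. i \<noteq> j \<and> e \<in> C i \<and> (\<forall>W. W \<subseteq> insert e (U \<sigma>) \<and> \<not> forest W \<longrightarrow> i \<in> W)"
      if "e \<in> A \<sigma> - U \<sigma>" "\<not> forest (insert e (U \<sigma>))" for e
    proof -
      have e: "e \<in> L" using that by (simp add: L_def)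
      then have "f e \<noteq> j" using J(1) j(1) by blast
      then show ?thesis using f[OF e] by (intro bexI[of _ "f e"]) blast+
    qed
    note unit = fire_from_unit[OF d \<tau> n fire[unfolded j(2)] witness]
    show ?thesis unfolding j(2) by (intro conjI ballI unit)
  qed
  moreover have "int (degree_sequence \<sigma> ?F k) = h_vector (dead_node M B \<sigma>) k" for k
    using unit_multicomplex(2)[OF f\<sigma> J\<sigma>, of k] dead_node_h_vector[OF d, of k] J(2)
    by (simp add: N_def)
  ultimately have "unconditional_fibre M B \<sigma> ?F"
    unfolding unconditional_fibre_def using unit_multicomplex(1)[OF f\<sigma> J\<sigma>] by blast
  then show ?thesis by blast
qed

end

section \<open>Breadth-first trees of depth two\<close>

lemma graph_dist_le:
  "walk G p \<Longrightarrow> hd p = u \<Longrightarrow> last p = v \<Longrightarrow> length p = Suc n \<Longrightarrow> graph_dist G u v \<le> n"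
  unfolding graph_dist_def by (rule Least_le) blast

lemma graph_dist_walk:
  assumes "graph_connected G" "u \<in> verts G" "v \<in> verts G"
  obtains p where "walk G p" "hd p = u" "last p = v" "length p = Suc (graph_dist G u v)"
proof -
  obtain p where p: "walk G p" "hd p = u" "last p = v"
    using assms by (auto simp: graph_connected_def)
  then have "length p = Suc (length p - 1)" by (cases p) (auto simp: walk_def)
  then have "\<exists>n p. walk G p \<and> hd p = u \<and> last p = v \<and> length p = Suc n" using p by blast
  then have "\<exists>p. walk G p \<and> hd p = u \<and> last p = v \<and> length p = Suc (graph_dist G u v)"
    unfolding graph_dist_def by (rule LeastI_ex)
  then show ?thesis using that by blast
qed

lemma parent_exists:
  assumes "graph_connected G" "c \<in> verts G" "v \<in> verts G" "v \<noteq> c"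
  shows "\<exists>w\<in>verts G. {w, v} \<in> edges G \<and> graph_dist G c w < graph_dist G c v"
proof -
  obtain p where p: "walk G p" "hd p = c" "last p = v" "length p = Suc (graph_dist G c v)"
    using graph_dist_walk[OF assms(1-3)] by blast
  have pne: "p \<noteq> []" using p(1) by (simp add: walk_def)
  define q where "q = butlast p"
  have pq: "p = q @ [v]" using append_butlast_last_id[OF pne] p(3) by (simp add: q_def)
  have qne: "q \<noteq> []" using p(2) assms(4) pq by auto
  have "walk G q" using p(1) qne by (auto simp: pq walk_def successively_append_iff)
  moreover have "hd q = c" using p(2) qne by (simp add: pq)
  moreover have "length q = Suc (graph_dist G c v - 1)" "0 < graph_dist G c v"
    using p(4) qne by (cases q; simp add: pq)+
  ultimately have "graph_dist G c (last q) < graph_dist G c v"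
    using graph_dist_le[of G q c "last q"] by fastforce
  moreover have "{last q, v} \<in> edges G" "last q \<in> verts G"
    using p(1) qne by (auto simp: pq walk_def successively_append_iff)
  ultimately show ?thesis by auto
qed

text \<open>Edges from a vertex to its parent are distinct for distinct vertices, since distances
  decrease. So there are already \<open>|V| - 1\<close> of them, and a forest has no more edges.\<close>

lemma tree_edges_are_parent_edges:
  assumes "simple_finite_graph T" "forest (edges T)" "graph_connected T" "c \<in> verts T"
  obtains par where
    "\<And>v. v \<in> verts T - {c} \<Longrightarrow> graph_dist T c (par v) < graph_dist T c v"
    "edges T = (\<lambda>v. {par v, v}) ` (verts T - {c})"
    "card (verts T) = card (edges T) + 1"
proof -
  have "\<forall>v\<in>verts T - {c}. \<exists>w. {w, v} \<in> edges T \<and> graph_dist T c w < graph_dist T c v"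
    using parent_exists[OF assms(3,4)] by blast
  then obtain par where par: "\<And>v. v \<in> verts T - {c} \<Longrightarrow>
      {par v, v} \<in> edges T \<and> graph_dist T c (par v) < graph_dist T c v"
    by metis
  let ?P = "(\<lambda>v. {par v, v}) ` (verts T - {c})"
  have fV: "finite (verts T)" and eV: "\<And>e. e \<in> edges T \<Longrightarrow> e \<subseteq> verts T \<and> card e = 2"
    using assms(1) by (auto simp: simple_finite_graph_def)
  have fE: "finite (edges T)" using fV eV by (meson PowI finite_Pow_iff finite_subset subsetI)
  have inj: "inj_on (\<lambda>v. {par v, v}) (verts T - {c})"
  proof (rule inj_onI)
    fix u v assume u: "u \<in> verts T - {c}" and v: "v \<in> verts T - {c}"
      and eq: "{par u, u} = {par v, v}"
    show "u = v"
    proof (rule ccontr)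
      assume "u \<noteq> v"
      then have "par u = v" "par v = u" using eq by (auto simp: doubleton_eq_iff)
      then show False using par[OF u] par[OF v] by simp
    qed
  qed
  have cP: "card ?P + 1 = card (verts T)"
    using card_image[OF inj] assms(4) fV by (metis Suc_eq_plus1 card_Suc_Diff1)
  have sub: "?P \<subseteq> edges T" using par by auto
  have "card (edges T) < card (verts T)"
  proof (cases "edges T = {}")
    case True then show ?thesis using assms(4) fV by (auto simp: card_gt_0_iff)
  next
    case False
    have "card (edges T) < card (\<Union>(edges T))"
      using forest_card_less_vertices[OF fE _ False assms(2)] eV by auto
    also have "\<dots> \<le> card (verts T)" using eV fV by (intro card_mono) auto
    finally show ?thesis .
  qed
  then have P: "?P = edges T" using cP sub fE by (intro card_seteq) auto
  show ?thesis using that[of par] par P cP by auto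
qed

text \<open>A vertex other than the centre has one tree edge to its parent; any further tree edge leads to
  a vertex at greater distance. At depth at most two this makes the vertex a hub with a child.\<close>

lemma radius_two_three_inner:
  assumes root: "radius_two_root G c B" and few: "card (fertile_hubs G c B) \<le> 2"
  shows "three_inner_vertices G B (insert c (fertile_hubs G c B))"
proof -
  define T where "T = \<lparr>verts = verts G, edges = B\<rparr>"
  have simple: "simple_finite_graph G" and c: "c \<in> verts G" and B: "B \<subseteq> edges G" "forest B"
    and T: "graph_connected T" and ecc: "eccentricity G c \<le> 2"
    and dist: "\<And>v. v \<in> verts G \<Longrightarrow> graph_dist T c v = graph_dist G c v"
    using root by (auto simp: radius_two_root_def bfs_spanning_tree_def spanning_tree_def T_def)
  have fV: "finite (verts G)" and eV: "\<And>e. e \<in> edges G \<Longrightarrow> e \<subseteq> verts G \<and> card e = 2"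
    using simple by (auto simp: simple_finite_graph_def)
  have fE: "finite (edges G)" using fV eV by (meson PowI finite_Pow_iff finite_subset subsetI)
  have fB: "finite B" using B fE finite_subset by blast
  have le2: "graph_dist T c v \<le> 2" if "v \<in> verts G" for v
  proof -
    have "graph_dist G c v \<le> eccentricity G c"
      unfolding eccentricity_def using that fV by (intro Max_ge) auto
    then show ?thesis using ecc dist[OF that] by simp
  qed
  have sT: "simple_finite_graph T" using simple B by (auto simp: simple_finite_graph_def T_def)
  obtain par where par: "\<And>v. v \<in> verts G - {c} \<Longrightarrow> graph_dist T c (par v) < graph_dist T c v"
    and BP: "B = (\<lambda>v. {par v, v}) ` (verts G - {c})" and cB: "card (verts G) = card B + 1"
    using tree_edges_are_parent_edges[OF sT _ T, of c] B(2) c by (auto simp: T_def)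
  show ?thesis
  proof
    show "simple_finite_graph G" "B \<subseteq> edges G" "forest B" by fact+
    show "\<not> forest (insert i B)" if i: "i \<in> edges G - B" for i
    proof
      \<comment> \<open>it would have as many edges as \<open>G\<close> has vertices\<close>
      assume "forest (insert i B)"
      then have "card (insert i B) < card (\<Union>(insert i B))"
        using fB i B(1) eV by (intro forest_card_less_vertices) auto
      also have "\<dots> \<le> card (verts G)" using i B(1) eV fV by (intro card_mono) blast+
      finally show False using cB i fB by simp
    qed
    have fin: "finite (fertile_hubs G c B)"
      using fV by (auto simp: fertile_hubs_def hubs_def)
    then show "finite (insert c (fertile_hubs G c B))" by simp
    show "card (insert c (fertile_hubs G c B)) \<le> 3"
      using few card_insert_le_m1[of 3 "fertile_hubs G c B" c] by simp
    fix v assume v: "v \<notin> insert c (fertile_hubs G c B)"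
    have up: "w = v" if w: "w \<in> verts G - {c}" and vw: "v \<in> {par w, w}" for w
    proof (rule ccontr)
      assume "w \<noteq> v"
      then have pw: "par w = v" using vw by auto
      have edge: "{v, w} \<in> B" using w by (auto simp: BP pw[symmetric])
      then have vV: "v \<in> verts G - {c}" using B(1) eV v by blast
      have dvw: "graph_dist T c v < graph_dist T c w" using par[OF w] pw by simp
      have pv: "graph_dist T c (par v) < graph_dist T c v" by (rule par[OF vV])
      have w2: "graph_dist T c w = 2" and p0: "graph_dist T c (par v) = 0"
        using le2[of w] w dvw pv by auto
      have pvB: "{par v, v} \<in> B" using vV by (auto simp: BP)
      then have "par v \<in> verts G" using B(1) eV by blast
      then have "par v = c"
      proof (cases "par v = c")
        case False
        then show ?thesis using par[of "par v"] p0 \<open>par v \<in> verts G\<close> by simp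
      qed
      then have "v \<in> hubs G c" using pvB B(1) vV by (auto simp: hubs_def)
      moreover have "w \<in> children G c" using w w2 dist by (auto simp: children_def)
      ultimately show False using v edge by (auto simp: fertile_hubs_def)
    qed
    have "{e \<in> B. v \<in> e} \<subseteq> {{par v, v}}"
    proof
      fix e assume e: "e \<in> {e \<in> B. v \<in> e}"
      then obtain w where "w \<in> verts G - {c}" "e = {par w, w}" by (auto simp: BP)
      then show "e \<in> {{par v, v}}" using up[of w] e by auto
    qed
    then have "card {e \<in> B. v \<in> e} \<le> card {{par v, v}}" by (intro card_mono) auto
    then show "vdeg B v \<le> 1" by (simp add: vdeg_def)
  qed
qed

theorem theorem6p1:
  fixes G :: "'v sgraph" and c :: 'v and B0 :: "'v set set"
  assumes "radius_two_root G c B0"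
    and "card (fertile_hubs G c B0) \<le> 2"
  shows "(\<forall>\<sigma>. dead (graphic_matroid G) B0 \<sigma> \<longrightarrow> rank (dead_node (graphic_matroid G) B0 \<sigma>) \<le> 1) \<and>
    (\<forall>\<sigma>. dead (graphic_matroid G) B0 \<sigma> \<longrightarrow> (\<exists>F. unconditional_fibre (graphic_matroid G) B0 \<sigma> F))"
proof -
  interpret three_inner_vertices G B0 "insert c (fertile_hubs G c B0)"
    using radius_two_three_inner[OF assms] .
  show ?thesis using dead_node_rank dead_unconditional_fibre by blast
qed

end
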